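(* There exists a constant $\beta\ge 0$ such that for every integer $k\ge 2$ there exists a constant $c>0$ (which may depend on $k$) such that, for the OFA-kf model with $p=p_c=1/k$, for every integer $L\ge 1$, $$c^{-1}L^2\le T_{\rm rel}\bigl(\mathbb T^k_L\bigr)\le c\,L^{2+\beta}.$$
   Context: Let $k\ge 2$ and let $\mathbb T^k$ be the infinite rooted $k$-ary tree (every vertex has exactly $k$ children) with root $r$. For a vertex $x$, $\mathcal K_x$ denotes the set of its $k$ children and $d_x$ its depth, i.e. the graph distance to $r$. For an integer $n\ge 0$ let $\mathbb T^k_n=\{x\in\mathbb T^k: d_x\le n\}$. Fix $p\in(0,1)$, $q=1-p$. Let $\mu_x$ be the Bernoulli measure on $\{0,1\}$ with $\mu_x(1)=p$, $\mu_x(0)=q$, and for a finite subtree $\mathbb T$ of $\mathbb T^k$ let $\mu_{\mathbb T}=\bigotimes_{x\in\mathbb T}\mu_x$ on $\Omega_{\mathbb T}=\{0,1\}^{\mathbb T}$. For $f:\Omega_{\mathbb T}\to\mathbb R$, $\mu_x(f)$ denotes the function obtained by averaging $f$ over the variable at $x$ with respect to $\mu_x$, the other variables being kept fixed; $\operatorname{Var}_{\mathbb T}$ is the variance under $\mu_{\mathbb T}$. Finite volume OFA-kf (oriented Fredrickson-Andersen $k$-facilitated) dynamics on $\mathbb T$: for $\eta\in\Omega_{\mathbb T}$ and $x\in\mathbb T$ let $c_{\mathbb T,x}(\eta)=1$ if $\eta_y=0$ for all $y\in\mathcal K_x\cap\mathbb T$ and $c_{\mathbb T,x}(\eta)=0$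 otherwise (children of $x$ outside $\mathbb T$ are regarded as empty, so for $\mathbb T=\mathbb T^k_n$ the leaves are unconstrained). The generator of the continuous time Markov chain, reversible with respect to $\mu_{\mathbb T}$, is $$\mathcal L_{\mathbb T}f=\sum_{x\in\mathbb T}c_{\mathbb T,x}\,[\mu_x(f)-f].$$ Its spectral gap is $\operatorname{gap}(\mathcal L_{\mathbb T})=\inf_{f\ne\text{const}}\frac{\mu_{\mathbb T}(f\cdot(-\mathcal L_{\mathbb T}f))}{\operatorname{Var}_{\mathbb T}(f)}$, and the relaxation time is $T_{\rm rel}(\mathbb T)=\operatorname{gap}(\mathcal L_{\mathbb T})^{-1}$. The critical density of the model is $p_c=1/k$. *)

theory Defs
  imports "HOL-Probability.Probability" "HOL-Probability.Product_PMF"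
begin

text \<open>
  A vertex of the rooted \<open>k\<close>-ary tree is the list of the child indices, all below \<open>k\<close>, read along
  the path from the root \<open>[]\<close>; its graph distance to the root is its length.
\<close>

type_synonym vertex = "nat list"

definition kary_tree :: "nat \<Rightarrow> vertex set" where
  "kary_tree k = lists {..<k}"

definition children :: "nat \<Rightarrow> vertex \<Rightarrow> vertex set" where
  "children k x = (\<lambda>i. x @ [i]) ` {..<k}"

definition depth :: "vertex \<Rightarrow> nat" where
  "depth x = length x"

definition finite_tree :: "nat \<Rightarrow> nat \<Rightarrow> vertex set" where
  "finite_tree k n = {x \<in> kary_tree k. depth x \<le> n}"

text \<open>
  The state \<open>1\<close> (of probability \<open>p\<close>) is \<open>True\<close>, the empty state \<open>0\<close> is \<open>False\<close>. Configurations on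
  \<open>T\<close> are total functions, extended by \<open>False\<close> outside \<open>T\<close>.
\<close>

type_synonym config = "vertex \<Rightarrow> bool"

definition configs :: "vertex set \<Rightarrow> config set" where
  "configs T = PiE_dflt T False (\<lambda>_. UNIV)"

definition site_measure :: "real \<Rightarrow> bool pmf" where
  "site_measure p = bernoulli_pmf p"

definition tree_measure :: "real \<Rightarrow> vertex set \<Rightarrow> config pmf" where
  "tree_measure p T = Pi_pmf T False (\<lambda>_. site_measure p)"

definition site_average :: "real \<Rightarrow> vertex \<Rightarrow> (config \<Rightarrow> real) \<Rightarrow> config \<Rightarrow> real" where
  "site_average p x f \<eta> = measure_pmf.expectation (site_measure p) (\<lambda>b. f (\<eta>(x := b)))"

definition constraint :: "nat \<Rightarrow> vertex set \<Rightarrow> vertex \<Rightarrow> config \<Rightarrow> real" where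
  "constraint k T x \<eta> = (if \<forall>y \<in> children k x \<inter> T. \<eta> y = False then 1 else 0)"

definition generator ::
    "nat \<Rightarrow> real \<Rightarrow> vertex set \<Rightarrow> (config \<Rightarrow> real) \<Rightarrow> config \<Rightarrow> real" where
  "generator k p T f \<eta> = (\<Sum>x\<in>T. constraint k T x \<eta> * (site_average p x f \<eta> - f \<eta>))"

definition spectral_gap :: "nat \<Rightarrow> real \<Rightarrow> vertex set \<Rightarrow> real" where
  "spectral_gap k p T =
     (INF f \<in> {f. \<not> f constant_on configs T}.
        measure_pmf.expectation (tree_measure p T) (\<lambda>\<eta>. f \<eta> * (- generator k p T f \<eta>))
        / measure_pmf.variance (tree_measure p T) f)"

text \<open>
  With real division a vanishing gap would give relaxation time \<open>0\<close> rather than infinity, so only a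
  strictly positive lower bound on the relaxation time excludes a vanishing gap.
\<close>

definition relaxation_time :: "nat \<Rightarrow> real \<Rightarrow> vertex set \<Rightarrow> real" where
  "relaxation_time k p T = inverse (spectral_gap k p T)"

definition critical_density :: "nat \<Rightarrow> real" where
  "critical_density k = 1 / real k"

end

theory Submission imports Defs begin

text \<open>
  The relaxation time is the best constant \<open>C\<close> in the Poincare inequality \<open>Var f \<le> C D(f)\<close>, where
  \<open>D(f)\<close> is the Dirichlet form, the sum over the sites \<open>x\<close> of the mean of \<open>c\<^sub>x Var\<^sub>x f\<close>.

  Upper bound: bisection of the depth. Instead of trees, slabs of \<open>l\<close> consecutive levels are used, so
  that the pieces of a slab are slabs again. Take off the top \<open>h\<close> levels, \<open>h \<approx> l / 3\<close>, and let \<open>B\<close> be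
  the remaining ones. Let \<open>M\<close> be the level at distance \<open>l - h\<close> below the top. A vertex above level \<open>M\<close>
  is shielded if no occupied path leads from one of its children down to level \<open>M\<close>. A shielded
  vertex does not influence which vertices are shielded, hence given the set \<open>G\<close> of the
  shielded vertices and the state of all other vertices, the states in \<open>G\<close> are still independent and
  Bernoulli; and a child of a vertex of \<open>G\<close> that is not itself in \<open>G\<close> is empty, so that \<open>G\<close> is not
  constrained from outside. Therefore both blocks \<open>B\<close> and \<open>G\<close> relax as fast as \<open>l - h\<close> levels
  (\<open>dirichlet_lower_levels\<close>, \<open>poincare_random_block\<close>).

  The two blocks together control the full variance. Let \<open>N\<close> be the average of \<open>f\<close> over the random
  block \<open>G\<close>. It depends on the state of \<open>x\<close> only if \<open>x\<close> is not shielded. So, when the levels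
  are revealed from the top, a level carries at most the fraction \<open>P(x not shielded)\<close> of the variance
  of \<open>N\<close> that is still left (\<open>var_erasure_level\<close>). At criticality this probability is the
  probability that a critical branching process survives for \<open>n\<close> generations, which is at most
  \<open>4 / (n + 4)\<close> for every \<open>k\<close>. The factors \<open>n / (n + 4)\<close> for the top \<open>h\<close> levels multiply to at least
  \<open>1 / 16\<close>, so at least this fraction of the variance of \<open>N\<close> is left inside \<open>B\<close>. Hence the
  Poincare constant of \<open>l\<close> levels is at most \<open>130\<close> times the one of \<open>l - h\<close> levels
  (\<open>poincare_bisection\<close>), and iteration gives a power of \<open>l\<close> that is the same for all \<open>k\<close>.

  Lower bound: the test function is the size of the occupied cluster of the root. If all children of
  \<open>x\<close> are empty, flipping \<open>x\<close> changes this size by one or not at all, and it changes it only if the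
  path from the root to \<open>x\<close> is occupied. A level contributes \<open>k\<^sup>d p\<^sup>d = 1\<close> to
  the Dirichlet form up to the factor \<open>p (1 - p)\<close>, so the form is at most of order \<open>L\<close>
  (\<open>dirichlet_cluster\<close>), while the variance of the cluster size is of order \<open>L\<^sup>3\<close> (\<open>var_cluster\<close>).
\<close>

section \<open>Averages and variances over finite sets of sites\<close>

definition override :: "'a set \<Rightarrow> 'a set \<Rightarrow> ('a \<Rightarrow> bool) \<Rightarrow> 'a \<Rightarrow> bool" where
  "override S A \<eta> = (\<lambda>v. if v \<in> S then v \<in> A else \<eta> v)"

definition agree_off :: "'a set \<Rightarrow> ('a \<Rightarrow> bool) \<Rightarrow> ('a \<Rightarrow> bool) \<Rightarrow> bool" where
  "agree_off S \<eta> \<eta>' \<longleftrightarrow> (\<forall>v. v \<notin> S \<longrightarrow> \<eta>' v = \<eta> v)"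

definition ignores :: "'a set \<Rightarrow> (('a \<Rightarrow> bool) \<Rightarrow> 'b) \<Rightarrow> bool" where
  "ignores S f \<longleftrightarrow> (\<forall>\<eta> \<eta>'. agree_off S \<eta> \<eta>' \<longrightarrow> f \<eta>' = f \<eta>)"

lemma agree_off_override: "agree_off S \<eta> (override S A \<eta>)"
  by (simp add: agree_off_def override_def)

lemma agree_off_mono: "agree_off S \<eta> \<eta>' \<Longrightarrow> S \<subseteq> T \<Longrightarrow> agree_off T \<eta> \<eta>'"
  by (auto simp: agree_off_def)

lemma agree_off_trans: "agree_off S \<eta> \<eta>' \<Longrightarrow> agree_off S \<eta>' \<eta>'' \<Longrightarrow> agree_off S \<eta> \<eta>''"
  by (auto simp: agree_off_def)

lemma ignoresD: "ignores S f \<Longrightarrow> agree_off S \<eta> \<eta>' \<Longrightarrow> f \<eta>' = f \<eta>"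
  by (auto simp: ignores_def)

lemma ignoresI: "(\<And>\<eta> \<eta>'. agree_off S \<eta> \<eta>' \<Longrightarrow> f \<eta>' = f \<eta>) \<Longrightarrow> ignores S f"
  by (auto simp: ignores_def)

lemma ignores_mono: "ignores T f \<Longrightarrow> S \<subseteq> T \<Longrightarrow> ignores S f"
  by (auto simp: ignores_def agree_off_def)

locale bernoulli_sites =
  fixes p :: real
  assumes p_pos: "0 < p" and p_less_1: "p < 1"
begin

definition weight :: "'a set \<Rightarrow> 'a set \<Rightarrow> real" where
  "weight S A = (\<Prod>x\<in>S. if x \<in> A then p else 1 - p)"

text \<open>
  Averaging over \<open>S\<close> is an operator on functions of all configurations, and \<open>var S f\<close> is again such a
  function: conditional expectations and conditional variances given the sites outside \<open>S\<close> can
  be iterated and compared pointwise.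
\<close>
definition av :: "'a set \<Rightarrow> (('a \<Rightarrow> bool) \<Rightarrow> real) \<Rightarrow> ('a \<Rightarrow> bool) \<Rightarrow> real" where
  "av S f \<eta> = (\<Sum>A\<in>Pow S. weight S A * f (override S A \<eta>))"

definition var :: "'a set \<Rightarrow> (('a \<Rightarrow> bool) \<Rightarrow> real) \<Rightarrow> ('a \<Rightarrow> bool) \<Rightarrow> real" where
  "var S f \<eta> = av S (\<lambda>\<sigma>. (f \<sigma>)\<^sup>2) \<eta> - (av S f \<eta>)\<^sup>2"

lemma weight_pos: "0 < weight S A"
  using p_pos p_less_1 by (auto simp: weight_def intro!: prod_pos)

lemma av_empty [simp]: "av {} f = f"
  by (rule ext) (simp add: av_def weight_def override_def)

lemma av_insert:
  assumes "finite S" "x \<notin> S"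
  shows "av (insert x S) f \<eta> = p * av S f (\<eta>(x := True)) + (1 - p) * av S f (\<eta>(x := False))"
proof -
  have inj: "inj_on (insert x) (Pow S)"
    using assms(2) by (auto simp: inj_on_def)
  have disj: "Pow S \<inter> insert x ` Pow S = {}"
    using assms(2) by auto
  have w1: "weight (insert x S) (insert x A) = p * weight S A" if "A \<in> Pow S" for A
  proof -
    have "(\<Prod>y\<in>S. if y \<in> insert x A then p else 1 - p) = (\<Prod>y\<in>S. if y \<in> A then p else 1 - p)"
      using assms(2) by (intro prod.cong) auto
    then show ?thesis using assms by (simp add: weight_def)
  qed
  have w0: "weight (insert x S) A = (1 - p) * weight S A" if "A \<in> Pow S" for A
    using assms that by (auto simp: weight_def)
  have o1: "override (insert x S) (insert x A) \<eta> = override S A (\<eta>(x := True))"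
    if "A \<in> Pow S" for A
    using assms(2) by (auto simp: override_def fun_eq_iff)
  have o0: "override (insert x S) A \<eta> = override S A (\<eta>(x := False))" if "A \<in> Pow S" for A
    using assms(2) that by (auto simp: override_def fun_eq_iff)
  have "av (insert x S) f \<eta>
      = (\<Sum>A\<in>Pow S. weight (insert x S) A * f (override (insert x S) A \<eta>))
        + (\<Sum>A\<in>insert x ` Pow S. weight (insert x S) A * f (override (insert x S) A \<eta>))"
    unfolding av_def Pow_insert by (rule sum.union_disjoint) (use assms disj in auto)
  also have "(\<Sum>A\<in>insert x ` Pow S. weight (insert x S) A * f (override (insert x S) A \<eta>))
      = (\<Sum>A\<in>Pow S. weight (insert x S) (insert x A) * f (override (insert x S) (insert x A) \<eta>))"
    using inj by (subst sum.reindex) auto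
  also have "\<dots> = p * av S f (\<eta>(x := True))"
    unfolding av_def sum_distrib_left by (rule sum.cong) (simp_all add: w1 o1)
  also have "(\<Sum>A\<in>Pow S. weight (insert x S) A * f (override (insert x S) A \<eta>))
      = (1 - p) * av S f (\<eta>(x := False))"
    unfolding av_def sum_distrib_left by (rule sum.cong) (simp_all add: w0 o0)
  finally show ?thesis by (simp only: add.commute)
qed

lemma av_single: "av {x} f \<eta> = p * f (\<eta>(x := True)) + (1 - p) * f (\<eta>(x := False))"
  by (simp add: av_insert)

lemma av_insert_av:
  assumes "finite S" "x \<notin> S"
  shows "av (insert x S) f = av {x} (av S f)"
  by (rule ext) (simp add: av_insert[OF assms] av_single)

lemma av_Un:
  assumes "finite S" "finite T" "S \<inter> T = {}"
  shows "av (S \<union> T) f = av S (av T f)"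
  using assms
proof (induction S rule: finite_induct)
  case (insert x S)
  have "av (insert x S \<union> T) f = av {x} (av (S \<union> T) f)"
    using insert av_insert_av[of "S \<union> T" x f] by simp
  also have "\<dots> = av {x} (av S (av T f))"
    using insert by simp
  also have "\<dots> = av (insert x S) (av T f)"
    using insert av_insert_av[of S x "av T f"] by simp
  finally show ?case .
qed simp

lemma av_commute:
  assumes "finite S" "finite T" "S \<inter> T = {}"
  shows "av S (av T f) = av T (av S f)"
proof -
  have "av S (av T f) = av (S \<union> T) f" using av_Un[OF assms] by simp
  also have "\<dots> = av (T \<union> S) f" by (simp only: Un_commute)
  also have "\<dots> = av T (av S f)" using assms by (intro av_Un) auto
  finally show ?thesis .
qed

lemma weight_sum: "finite S \<Longrightarrow> (\<Sum>A\<in>Pow S. weight S A) = 1"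
proof -
  assume "finite S"
  then have "av S (\<lambda>_. 1) \<eta> = 1" for \<eta>
    by (induction S arbitrary: \<eta> rule: finite_induct) (simp_all add: av_insert)
  then show ?thesis by (simp add: av_def)
qed

lemma av_const [simp]: "finite S \<Longrightarrow> av S (\<lambda>_. c) \<eta> = c"
  by (simp add: av_def weight_sum flip: sum_distrib_right)

lemma av_cong:
  assumes "\<And>\<sigma>. agree_off S \<eta> \<sigma> \<Longrightarrow> f \<sigma> = g \<sigma>"
  shows "av S f \<eta> = av S g \<eta>"
  unfolding av_def by (rule sum.cong) (simp_all add: assms[OF agree_off_override])

lemma av_mono:
  assumes "\<And>\<sigma>. agree_off S \<eta> \<sigma> \<Longrightarrow> f \<sigma> \<le> g \<sigma>"
  shows "av S f \<eta> \<le> av S g \<eta>"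
  unfolding av_def
  by (intro sum_mono mult_left_mono assms agree_off_override order_less_imp_le[OF weight_pos])

lemma av_nonneg:
  assumes "\<And>\<sigma>. agree_off S \<eta> \<sigma> \<Longrightarrow> 0 \<le> f \<sigma>"
  shows "0 \<le> av S f \<eta>"
  unfolding av_def
  by (intro sum_nonneg mult_nonneg_nonneg assms agree_off_override order_less_imp_le[OF weight_pos])

lemma av_add: "av S (\<lambda>\<sigma>. f \<sigma> + g \<sigma>) \<eta> = av S f \<eta> + av S g \<eta>"
  by (simp add: av_def distrib_left sum.distrib)

lemma av_diff: "av S (\<lambda>\<sigma>. f \<sigma> - g \<sigma>) \<eta> = av S f \<eta> - av S g \<eta>"
  by (simp add: av_def right_diff_distrib sum_subtractf)

lemma av_cmult: "av S (\<lambda>\<sigma>. c * f \<sigma>) \<eta> = c * av S f \<eta>"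
  by (simp add: av_def sum_distrib_left mult.left_commute)

lemma av_sum: "av S (\<lambda>\<sigma>. \<Sum>i\<in>I. f i \<sigma>) \<eta> = (\<Sum>i\<in>I. av S (f i) \<eta>)"
  unfolding av_def sum_distrib_left by (rule sum.swap)

lemma av_agree:
  assumes "agree_off S \<eta> \<eta>'"
  shows "av S f \<eta>' = av S f \<eta>"
proof -
  have "override S A \<eta>' = override S A \<eta>" for A
    using assms by (auto simp: override_def agree_off_def)
  then show ?thesis by (simp add: av_def)
qed

lemma ignores_av_self: "ignores S (av S f)"
  by (rule ignoresI) (rule av_agree)

lemma ignores_av:
  assumes "ignores T f"
  shows "ignores T (av S f)"
proof (rule ignoresI)
  fix \<eta> \<eta>' :: "'a \<Rightarrow> bool"
  assume *: "agree_off T \<eta> \<eta>'"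
  have "f (override S A \<eta>') = f (override S A \<eta>)" for A
    using * by (intro ignoresD[OF assms]) (auto simp: agree_off_def override_def)
  then show "av S f \<eta>' = av S f \<eta>" by (simp add: av_def)
qed

lemma av_mult_ignores:
  assumes "ignores S f"
  shows "av S (\<lambda>\<sigma>. f \<sigma> * g \<sigma>) \<eta> = f \<eta> * av S g \<eta>"
proof -
  have "av S (\<lambda>\<sigma>. f \<sigma> * g \<sigma>) \<eta> = av S (\<lambda>\<sigma>. f \<eta> * g \<sigma>) \<eta>"
    by (rule av_cong) (metis assms ignoresD)
  then show ?thesis by (simp add: av_cmult)
qed

lemma av_ignores: "finite S \<Longrightarrow> ignores S f \<Longrightarrow> av S f = f"
  using av_mult_ignores[of S f "\<lambda>_. 1"] by (simp add: fun_eq_iff)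

text \<open>The tower property.\<close>
lemma av_av_subset:
  assumes "finite V" "S \<subseteq> V"
  shows "av V (av S f) = av V f"
proof -
  have fin: "finite S" using assms finite_subset by blast
  have V: "V - S \<union> S = V" using assms by blast
  have split: "av V g = av (V - S) (av S g)" for g :: "('a \<Rightarrow> bool) \<Rightarrow> real"
    using av_Un[of "V - S" S g] assms fin unfolding V by blast
  have "av V (av S f) = av (V - S) (av S (av S f))"
    by (rule split)
  also have "av S (av S f) = av S f"
    using fin by (intro av_ignores ignores_av_self)
  also have "av (V - S) (av S f) = av V f"
    by (rule split[symmetric])
  finally show ?thesis .
qed

lemma av_restrict:
  assumes "finite V" "S \<subseteq> V" "ignores (V - S) f"
  shows "av V f = av S f"
proof -
  have fin: "finite S" using assms finite_subset by blast
  have V: "S \<union> (V - S) = V" using assms by blast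
  have "av V f = av S (av (V - S) f)"
    using av_Un[of S "V - S" f] assms fin unfolding V by blast
  also have "av (V - S) f = f"
    using assms by (intro av_ignores) auto
  finally show ?thesis .
qed

lemma av_site_average: "av {x} f \<eta> = site_average p x f \<eta>" for x :: vertex
  using p_pos p_less_1 by (simp add: av_single site_average_def site_measure_def)

lemma var_eq:
  assumes "finite S"
  shows "var S f \<eta> = av S (\<lambda>\<sigma>. (f \<sigma> - av S f \<eta>)\<^sup>2) \<eta>"
proof -
  define m where "m = av S f \<eta>"
  have "av S (\<lambda>\<sigma>. (f \<sigma> - m)\<^sup>2) \<eta> = av S (\<lambda>\<sigma>. ((f \<sigma>)\<^sup>2 - (2 * m) * f \<sigma>) + m\<^sup>2) \<eta>"
    by (simp add: power2_diff algebra_simps)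
  also have "\<dots> = av S (\<lambda>\<sigma>. (f \<sigma>)\<^sup>2) \<eta> - (2 * m) * m + m\<^sup>2"
    unfolding av_add av_diff av_cmult av_const[OF assms] m_def ..
  finally show ?thesis by (simp add: var_def m_def power2_eq_square)
qed

lemma var_nonneg: "finite S \<Longrightarrow> 0 \<le> var S f \<eta>"
  by (simp add: var_eq av_nonneg)

lemma square_av_le: "finite S \<Longrightarrow> (av S f \<eta>)\<^sup>2 \<le> av S (\<lambda>\<sigma>. (f \<sigma>)\<^sup>2) \<eta>"
  using var_nonneg[of S f \<eta>] by (simp add: var_def)

lemma var_shift:
  assumes "finite S"
  shows "var S (\<lambda>\<sigma>. f \<sigma> - c) \<eta> = var S f \<eta>"
  by (simp add: var_eq assms av_diff)

lemma var_le_square: 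
  assumes "finite S"
  shows "var S f \<eta> \<le> av S (\<lambda>\<sigma>. (f \<sigma> - c)\<^sup>2) \<eta>"
proof -
  have "var S f \<eta> = var S (\<lambda>\<sigma>. f \<sigma> - c) \<eta>" using assms by (simp add: var_shift)
  also have "\<dots> \<le> av S (\<lambda>\<sigma>. (f \<sigma> - c)\<^sup>2) \<eta>" by (simp add: var_def)
  finally show ?thesis .
qed

lemma var_cong:
  assumes "\<And>\<sigma>. agree_off S \<eta> \<sigma> \<Longrightarrow> f \<sigma> = g \<sigma>"
  shows "var S f \<eta> = var S g \<eta>"
proof -
  have "av S f \<eta> = av S g \<eta>" using assms by (rule av_cong)
  moreover have "av S (\<lambda>\<sigma>. (f \<sigma>)\<^sup>2) \<eta> = av S (\<lambda>\<sigma>. (g \<sigma>)\<^sup>2) \<eta>"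
    by (rule av_cong) (simp add: assms)
  ultimately show ?thesis by (simp add: var_def)
qed

lemma var_ignores:
  assumes "finite S" "ignores S f"
  shows "var S f \<eta> = 0"
proof -
  have "ignores S (\<lambda>\<sigma>. (f \<sigma>)\<^sup>2)" using assms(2) by (auto simp: ignores_def)
  then show ?thesis using assms by (simp add: var_def av_ignores)
qed

lemma ignores_square: "ignores S f \<Longrightarrow> ignores S (\<lambda>\<sigma>. (f \<sigma>)\<^sup>2)" for f :: "('a \<Rightarrow> bool) \<Rightarrow> real"
  by (auto simp: ignores_def)

lemma ignores_var:
  assumes "ignores T f"
  shows "ignores T (var S f)"
proof (rule ignoresI)
  fix \<eta> \<eta>' assume a: "agree_off T \<eta> \<eta>'"
  show "var S f \<eta>' = var S f \<eta>"
    using ignoresD[OF ignores_av[OF assms] a] ignoresD[OF ignores_av[OF ignores_square[OF assms]] a]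
    by (simp add: var_def)
qed

lemma ignores_var_self: "ignores S (var S f)"
  by (rule ignoresI) (simp add: var_def av_agree)

lemma var_restrict:
  assumes "finite V" "S \<subseteq> V" "ignores (V - S) f"
  shows "var V f = var S f"
proof
  fix \<eta>
  have "ignores (V - S) (\<lambda>\<sigma>. (f \<sigma>)\<^sup>2)" using assms(3) by (rule ignores_square)
  then show "var V f \<eta> = var S f \<eta>"
    using assms by (simp add: var_def av_restrict[OF assms(1,2)])
qed

lemma var_add_le:
  assumes "finite S"
  shows "var S (\<lambda>\<sigma>. f \<sigma> + g \<sigma>) \<eta> \<le> 2 * var S f \<eta> + 2 * var S g \<eta>"
proof -
  define a b where "a = av S f \<eta>" and "b = av S g \<eta>"
  have "var S (\<lambda>\<sigma>. f \<sigma> + g \<sigma>) \<eta> = av S (\<lambda>\<sigma>. ((f \<sigma> - a) + (g \<sigma> - b))\<^sup>2) \<eta>"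
    by (simp add: var_eq assms av_add a_def b_def algebra_simps)
  also have "\<dots> \<le> av S (\<lambda>\<sigma>. 2 * (f \<sigma> - a)\<^sup>2 + 2 * (g \<sigma> - b)\<^sup>2) \<eta>"
  proof (rule av_mono)
    fix \<sigma>
    show "((f \<sigma> - a) + (g \<sigma> - b))\<^sup>2 \<le> 2 * (f \<sigma> - a)\<^sup>2 + 2 * (g \<sigma> - b)\<^sup>2"
      using sum_squares_bound[of "f \<sigma> - a" "g \<sigma> - b"]
      unfolding power2_sum by linarith
  qed
  also have "\<dots> = 2 * var S f \<eta> + 2 * var S g \<eta>"
    by (simp add: av_add av_cmult var_eq assms a_def b_def)
  finally show ?thesis .
qed

lemma av_cauchy_schwarz:
  assumes "finite S"
  shows "(av S (\<lambda>\<sigma>. f \<sigma> * g \<sigma>) \<eta>)\<^sup>2 \<le> av S (\<lambda>\<sigma>. (f \<sigma>)\<^sup>2) \<eta> * av S (\<lambda>\<sigma>. (g \<sigma>)\<^sup>2) \<eta>"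
proof -
  define w where "w A = sqrt (weight S A)" for A
  have w: "w A * w A = weight S A" for A
    by (simp add: w_def order_less_imp_le[OF weight_pos])
  have "(\<Sum>A\<in>Pow S. (w A * f (override S A \<eta>)) * (w A * g (override S A \<eta>)))\<^sup>2
    \<le> (\<Sum>A\<in>Pow S. (w A * f (override S A \<eta>))\<^sup>2) * (\<Sum>A\<in>Pow S. (w A * g (override S A \<eta>))\<^sup>2)"
    by (rule Cauchy_Schwarz_ineq_sum)
  moreover have "(w A * a) * (w A * b) = weight S A * (a * b)" "(w A * a)\<^sup>2 = weight S A * a\<^sup>2" for A a b
    by (simp_all add: w[symmetric] power2_eq_square)
  ultimately show ?thesis by (simp add: av_def)
qed

text \<open>The law of total variance.\<close>
lemma var_Un:
  assumes "finite S" "finite T" "S \<inter> T = {}"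
  shows "var (S \<union> T) f \<eta> = av S (var T f) \<eta> + var S (av T f) \<eta>"
proof -
  have "av S (var T f) \<eta> = av S (av T (\<lambda>\<sigma>. (f \<sigma>)\<^sup>2)) \<eta> - av S (\<lambda>\<sigma>. (av T f \<sigma>)\<^sup>2) \<eta>"
    unfolding var_def by (rule av_diff)
  then show ?thesis by (simp add: var_def av_Un[OF assms])
qed

text \<open>
  Jensen's inequality for the square: the deviation of \<open>av T f\<close> from its mean over \<open>S\<close> is the
  average over \<open>T\<close> of the deviation of \<open>f\<close>.
\<close>
lemma var_av_le:
  assumes "finite S" "finite T" "S \<inter> T = {}"
  shows "var S (av T f) \<eta> \<le> av T (var S f) \<eta>"
proof -
  define g where "g = av S f"
  have ig: "ignores S (av T g)"
    unfolding g_def by (intro ignores_av ignores_av_self)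
  have m: "av S (av T f) \<eta> = av T g \<eta>"
    unfolding g_def by (simp only: av_commute[OF assms])
  have "var S (av T f) \<eta> = av S (\<lambda>\<sigma>. (av T f \<sigma> - av T g \<eta>)\<^sup>2) \<eta>"
    using assms(1) by (simp add: var_eq m)
  also have "\<dots> = av S (\<lambda>\<sigma>. (av T (\<lambda>\<sigma>. f \<sigma> - g \<sigma>) \<sigma>)\<^sup>2) \<eta>"
    by (rule av_cong) (simp add: av_diff ignoresD[OF ig])
  also have "\<dots> \<le> av S (av T (\<lambda>\<sigma>. (f \<sigma> - g \<sigma>)\<^sup>2)) \<eta>"
    by (rule av_mono) (rule square_av_le[OF assms(2)])
  also have "\<dots> = av T (av S (\<lambda>\<sigma>. (f \<sigma> - g \<sigma>)\<^sup>2)) \<eta>"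
    by (simp only: av_commute[OF assms])
  also have "\<dots> = av T (var S f) \<eta>"
  proof (rule av_cong)
    fix \<sigma>
    have "av S (\<lambda>\<sigma>. (f \<sigma> - g \<sigma>)\<^sup>2) \<sigma> = av S (\<lambda>\<tau>. (f \<tau> - g \<sigma>)\<^sup>2) \<sigma>"
      unfolding g_def by (rule av_cong) (simp add: av_agree)
    then show "av S (\<lambda>\<sigma>. (f \<sigma> - g \<sigma>)\<^sup>2) \<sigma> = var S f \<sigma>"
      using assms(1) by (simp add: var_eq g_def)
  qed
  finally show ?thesis .
qed

text \<open>The Efron-Stein inequality: for product measures, unconstrained dynamics has gap at least one.\<close>
lemma var_le_sum_var:
  assumes "finite S"
  shows "var S f \<eta> \<le> (\<Sum>y\<in>S. av S (var {y} f) \<eta>)"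
  using assms
proof (induction S arbitrary: \<eta> rule: finite_induct)
  case empty
  then show ?case by (simp add: var_def)
next
  case (insert x S)
  have "var (insert x S) f \<eta> = av {x} (var S f) \<eta> + var {x} (av S f) \<eta>"
    using var_Un[of "{x}" S f \<eta>] insert by simp
  also have "av {x} (var S f) \<eta> \<le> av {x} (\<lambda>\<sigma>. \<Sum>y\<in>S. av S (var {y} f) \<sigma>) \<eta>"
    by (rule av_mono) (rule insert.IH)
  also have "\<dots> = (\<Sum>y\<in>S. av (insert x S) (var {y} f) \<eta>)"
    unfolding av_sum using insert av_insert_av[of S x] by simp
  also have "var {x} (av S f) \<eta> \<le> av S (var {x} f) \<eta>"
    using insert by (intro var_av_le) auto
  also have "\<dots> = av (insert x S) (var {x} f) \<eta>"
    using insert.hyps by (subst av_restrict[of "insert x S" S])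
      (auto intro: ignores_mono[OF ignores_var_self])
  finally show ?case using insert by simp
qed

section \<open>Loss of variance when sites are erased\<close>
lemma ignores_comp: "ignores S f \<Longrightarrow> ignores S (\<lambda>\<sigma>. h (f \<sigma>))"
  by (simp add: ignores_def)

lemma ignores_comp2: "ignores S f \<Longrightarrow> ignores S g \<Longrightarrow> ignores S (\<lambda>\<sigma>. h (f \<sigma>) (g \<sigma>))"
  unfolding ignores_def by metis

text \<open>
  The site \<open>x\<close> is erased when \<open>c = 1\<close>: then \<open>N\<close> does not see it. So the variance \<open>s\<close> of \<open>N\<close> that
  is due to \<open>x\<close> alone comes from the event \<open>c = 0\<close>. It is the covariance of \<open>N\<close> with the centred
  conditional mean \<open>\<phi>\<close> given \<open>x\<close>, restricted to that event, and the Cauchy-Schwarz inequality costs a factor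
  \<open>P(c = 0)\<close>, which is at most \<open>1 - \<kappa>\<close>: \<open>s\<^sup>2 \<le> (1 - \<kappa>) s Var N\<close>.
\<close>
lemma var_erasure_site:
  assumes "finite W" "x \<notin> W"
    and c01: "\<And>\<sigma>. c \<sigma> = 0 \<or> c \<sigma> = 1"
    and c_x: "ignores {x} c" and cN: "ignores {x} (\<lambda>\<sigma>. c \<sigma> * N \<sigma>)"
    and \<kappa>: "\<And>\<sigma>. \<kappa> \<le> av W c \<sigma>"
  shows "\<kappa> * var (insert x W) N \<eta> \<le> av {x} (var W N) \<eta>"
proof -
  define m where "m = av (insert x W) N \<eta>"
  define \<phi> where "\<phi> \<sigma> = av W N \<sigma> - m" for \<sigma>
  define v s where "v = var (insert x W) N \<eta>" and "s = var {x} (av W N) \<eta>"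
  have insx: "av (insert x W) f = av {x} (av W f)" for f
    using assms by (intro av_insert_av) auto
  have com: "av {x} (av W f) = av W (av {x} f)" for f
    using assms by (intro av_commute) auto
  have split: "v = av {x} (var W N) \<eta> + s"
    using var_Un[of "{x}" W N \<eta>] assms by (simp add: v_def s_def)
  have \<phi>W: "ignores W \<phi>"
    unfolding \<phi>_def by (rule ignores_comp[OF ignores_av_self])
  have \<phi>W2: "ignores W (\<lambda>\<sigma>. (\<phi> \<sigma>)\<^sup>2)"
    by (rule ignores_square[OF \<phi>W])
  have m: "m = av {x} (av W N) \<eta>"
    by (simp add: m_def insx)
  have s: "s = av {x} (\<lambda>\<sigma>. (\<phi> \<sigma>)\<^sup>2) \<eta>"
    by (simp add: s_def var_eq \<phi>_def m)
  have \<phi>0: "av {x} \<phi> \<sigma> = 0" if "agree_off W \<eta> \<sigma>" for \<sigma>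
  proof -
    have "av {x} \<phi> \<sigma> = av {x} \<phi> \<eta>"
      by (rule ignoresD[OF ignores_av[OF \<phi>W] that])
    also have "\<dots> = 0"
      unfolding \<phi>_def av_diff by (simp add: m)
    finally show ?thesis .
  qed
  \<comment> \<open>\<open>\<phi>\<close> is the conditional mean of \<open>N - m\<close>, so their covariance is the variance of \<open>\<phi>\<close>.\<close>
  have full: "av (insert x W) (\<lambda>\<sigma>. \<phi> \<sigma> * (N \<sigma> - m)) \<eta> = s"
  proof -
    have "av W (\<lambda>\<sigma>. \<phi> \<sigma> * (N \<sigma> - m)) = (\<lambda>\<sigma>. (\<phi> \<sigma>)\<^sup>2)"
      using assms(1) by (intro ext) (simp add: av_mult_ignores[OF \<phi>W] av_diff, simp add: \<phi>_def power2_eq_square)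
    then show ?thesis by (simp add: insx s)
  qed
  \<comment> \<open>On \<open>c = 1\<close> the average over \<open>x\<close> only meets \<open>\<phi>\<close>, which is centred.\<close>
  have good: "av (insert x W) (\<lambda>\<sigma>. (c \<sigma> * (N \<sigma> - m)) * \<phi> \<sigma>) \<eta> = 0"
  proof -
    have ig: "ignores {x} (\<lambda>\<sigma>. c \<sigma> * (N \<sigma> - m))"
      unfolding right_diff_distrib by (rule ignores_comp2[OF cN ignores_comp[OF c_x]])
    have "av (insert x W) (\<lambda>\<sigma>. (c \<sigma> * (N \<sigma> - m)) * \<phi> \<sigma>) \<eta>
        = av W (av {x} (\<lambda>\<sigma>. (c \<sigma> * (N \<sigma> - m)) * \<phi> \<sigma>)) \<eta>"
      by (simp only: insx com)
    also have "\<dots> = av W (\<lambda>_. 0) \<eta>"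
      by (rule av_cong) (simp add: av_mult_ignores[OF ig] \<phi>0)
    finally show ?thesis using assms(1) by simp
  qed
  have bad: "av (insert x W) (\<lambda>\<sigma>. (\<phi> \<sigma> * (1 - c \<sigma>)) * (N \<sigma> - m)) \<eta> = s"
  proof -
    have "(\<lambda>\<sigma>. (\<phi> \<sigma> * (1 - c \<sigma>)) * (N \<sigma> - m))
        = (\<lambda>\<sigma>. \<phi> \<sigma> * (N \<sigma> - m) - (c \<sigma> * (N \<sigma> - m)) * \<phi> \<sigma>)"
      by (simp add: algebra_simps)
    then show ?thesis by (simp only: av_diff full good)
  qed
  \<comment> \<open>\<open>\<phi>\<close> is a function of \<open>x\<close> and \<open>c\<close> is not, so the probability of \<open>c = 0\<close> factors out.\<close>
  have small: "av (insert x W) (\<lambda>\<sigma>. (\<phi> \<sigma> * (1 - c \<sigma>))\<^sup>2) \<eta> \<le> (1 - \<kappa>) * s"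
  proof -
    have "av W (\<lambda>\<sigma>. (\<phi> \<sigma> * (1 - c \<sigma>))\<^sup>2) \<sigma> \<le> (1 - \<kappa>) * (\<phi> \<sigma>)\<^sup>2" for \<sigma>
    proof -
      have "(\<lambda>\<sigma>. (\<phi> \<sigma> * (1 - c \<sigma>))\<^sup>2) = (\<lambda>\<sigma>. (\<phi> \<sigma>)\<^sup>2 * (1 - c \<sigma>))"
      proof
        fix \<sigma>
        show "(\<phi> \<sigma> * (1 - c \<sigma>))\<^sup>2 = (\<phi> \<sigma>)\<^sup>2 * (1 - c \<sigma>)"
          using c01[of \<sigma>] by auto
      qed
      then have "av W (\<lambda>\<sigma>. (\<phi> \<sigma> * (1 - c \<sigma>))\<^sup>2) \<sigma> = (\<phi> \<sigma>)\<^sup>2 * (1 - av W c \<sigma>)"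
        using assms(1) by (simp add: av_mult_ignores[OF \<phi>W2] av_diff)
      also have "\<dots> \<le> (\<phi> \<sigma>)\<^sup>2 * (1 - \<kappa>)"
        by (rule mult_left_mono) (use \<kappa>[of \<sigma>] in auto)
      finally show ?thesis by (simp add: mult.commute)
    qed
    then have "av {x} (av W (\<lambda>\<sigma>. (\<phi> \<sigma> * (1 - c \<sigma>))\<^sup>2)) \<eta> \<le> av {x} (\<lambda>\<sigma>. (1 - \<kappa>) * (\<phi> \<sigma>)\<^sup>2) \<eta>"
      by (intro av_mono)
    then show ?thesis by (simp add: insx av_cmult s)
  qed
  have v: "av (insert x W) (\<lambda>\<sigma>. (N \<sigma> - m)\<^sup>2) \<eta> = v"
    using assms(1) by (simp add: v_def var_eq m_def)
  have v0: "0 \<le> v" and s0: "0 \<le> s"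
    using assms(1) by (simp_all add: v_def s_def var_nonneg)
  have "s\<^sup>2 \<le> av (insert x W) (\<lambda>\<sigma>. (\<phi> \<sigma> * (1 - c \<sigma>))\<^sup>2) \<eta> * v"
    using av_cauchy_schwarz[of "insert x W" "\<lambda>\<sigma>. \<phi> \<sigma> * (1 - c \<sigma>)" "\<lambda>\<sigma>. N \<sigma> - m" \<eta>] assms(1)
    by (simp only: bad v finite_insert)
  also have "\<dots> \<le> (1 - \<kappa>) * s * v"
    by (rule mult_right_mono[OF small v0])
  finally have sq: "s * s \<le> s * ((1 - \<kappa>) * v)"
    by (simp add: power2_eq_square algebra_simps)
  have \<kappa>1: "\<kappa> \<le> 1"
  proof -
    have "\<kappa> \<le> av W c \<eta>" by (rule \<kappa>)
    also have "\<dots> \<le> av W (\<lambda>_. 1) \<eta>" by (rule av_mono) (metis c01 order_refl zero_le_one)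
    finally show ?thesis using assms(1) by simp
  qed
  have "s \<le> (1 - \<kappa>) * v"
  proof (cases "s = 0")
    case True
    then show ?thesis using v0 \<kappa>1 by simp
  next
    case False
    then show ?thesis using sq s0 by simp
  qed
  then show ?thesis
    using split by (simp add: v_def[symmetric] algebra_simps)
qed

text \<open>
  Many sites can be revealed at once at the price of a single factor \<open>\<kappa>\<close>, if their
  erasures depend on disjoint sets of sites. The law of total variance adds the blocks \<open>{x} \<union> W x\<close> one by
  one: the conditional variance given the new block is covered by the induction, the variance due to the
  new block by the bound for a single site, so \<open>\<kappa>\<close> is never multiplied with itself.
\<close>
lemma var_erasure_level:
  assumes "finite X" and "\<And>x. x \<in> X \<Longrightarrow> finite (W x)" and "\<And>x. x \<in> X \<Longrightarrow> W x \<inter> X = {}"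
    and "\<And>x y. x \<in> X \<Longrightarrow> y \<in> X \<Longrightarrow> x \<noteq> y \<Longrightarrow> W x \<inter> W y = {}"
    and "\<And>x \<sigma>. x \<in> X \<Longrightarrow> c x \<sigma> = 0 \<or> c x \<sigma> = 1"
    and "\<And>x. x \<in> X \<Longrightarrow> ignores (- W x) (c x)"
    and "\<And>x \<sigma>. x \<in> X \<Longrightarrow> \<kappa> \<le> av (W x) (c x) \<sigma>" and "0 \<le> \<kappa>"
    and "\<And>x. x \<in> X \<Longrightarrow> ignores {x} (\<lambda>\<sigma>. c x \<sigma> * N \<sigma>)"
  shows "\<kappa> * var (X \<union> \<Union>(W ` X)) N \<eta> \<le> av X (var (\<Union>(W ` X)) N) \<eta>"
  using assms
proof (induction X arbitrary: N \<eta> rule: finite_induct)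
  case empty
  then show ?case by (simp add: var_def)
next
  case (insert x X)
  define W' where "W' = \<Union>(W ` X)"
  define U where "U = X \<union> W'"
  have fin: "finite (W x)" "finite W'" "finite U" "finite X"
    using insert.prems(1) insert.hyps by (auto simp: W'_def U_def)
  have xW: "x \<notin> W x" "x \<notin> U" and XW: "W x \<inter> X = {}" and WW: "W x \<inter> W' = {}" and XW': "X \<inter> W' = {}"
    using insert.prems(2) insert.prems(3)[of x] insert.hyps by (auto simp: W'_def U_def)
  then have WU: "W x \<inter> U = {}" by (auto simp: U_def)
  have c_out: "ignores S (c x)" if "S \<inter> W x = {}" for S
    using insert.prems(5)[of x] that by (auto intro: ignores_mono)
  have IH: "\<kappa> * var U N \<sigma> \<le> av X (var W' N) \<sigma>" for \<sigma>
    unfolding U_def W'_def by (rule insert.IH) (use insert.prems in auto)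
  have cU: "(\<lambda>\<sigma>. c x \<sigma> * av U N \<sigma>) = av U (\<lambda>\<sigma>. c x \<sigma> * N \<sigma>)"
    using av_mult_ignores[OF c_out, of U N] WU by (auto simp: fun_eq_iff Int_commute)
  have site: "\<kappa> * var (insert x (W x)) (av U N) \<eta> \<le> av {x} (var (W x) (av U N)) \<eta>"
  proof (rule var_erasure_site[where c = "c x"])
    show "ignores {x} (\<lambda>\<sigma>. c x \<sigma> * av U N \<sigma>)"
      unfolding cU by (rule ignores_av) (simp add: insert.prems)
    show "ignores {x} (c x)" using xW by (intro c_out) auto
  qed (use fin xW insert.prems in auto)
  have "\<kappa> * var (insert x (W x) \<union> U) N \<eta>
      = av (insert x (W x)) (\<lambda>\<sigma>. \<kappa> * var U N \<sigma>) \<eta> + \<kappa> * var (insert x (W x)) (av U N) \<eta>"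
    using fin xW WU by (subst var_Un) (auto simp: distrib_left av_cmult)
  also have "\<dots> \<le> av (insert x (W x)) (av X (var W' N)) \<eta> + av {x} (var (W x) (av U N)) \<eta>"
    by (intro add_mono site av_mono IH)
  also have "av {x} (var (W x) (av U N)) \<eta> \<le> av {x} (av X (var (W x) (av W' N))) \<eta>"
  proof (rule av_mono)
    fix \<sigma>
    have "av U N = av X (av W' N)"
      unfolding U_def using fin XW' by (intro av_Un)
    then show "var (W x) (av U N) \<sigma> \<le> av X (var (W x) (av W' N)) \<sigma>"
      using fin XW by (simp add: var_av_le)
  qed
  also have "av (insert x (W x)) (av X (var W' N)) \<eta> = av {x} (av X (av (W x) (var W' N))) \<eta>"
    using fin xW XW av_insert_av[of "W x" x] av_commute[of "W x" X] by simp
  also have "av {x} (av X (av (W x) (var W' N))) \<eta> + av {x} (av X (var (W x) (av W' N))) \<eta>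
      = av {x} (av X (var (W x \<union> W') N)) \<eta>"
  proof -
    have "var (W x \<union> W') N \<sigma> = av (W x) (var W' N) \<sigma> + var (W x) (av W' N) \<sigma>" for \<sigma>
      using fin WW by (intro var_Un)
    then have "var (W x \<union> W') N = (\<lambda>\<sigma>. av (W x) (var W' N) \<sigma> + var (W x) (av W' N) \<sigma>)"
      by (rule ext)
    then have "av X (var (W x \<union> W') N) 
      = (\<lambda>\<sigma>. av X (av (W x) (var W' N)) \<sigma> + av X (var (W x) (av W' N)) \<sigma>)"
      by (intro ext) (simp only: av_add)
    then show ?thesis by (simp only: av_add)
  qed
  also have "\<dots> = av (insert x X) (var (W x \<union> W') N) \<eta>"
    using fin insert.hyps av_insert_av[of X x] by simp
  finally show ?case
    by (simp add: U_def W'_def Un_ac)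
qed

lemma av_prod:
  assumes "finite I" and "\<And>i. i \<in> I \<Longrightarrow> finite (S i)"
    and "\<And>i j. i \<in> I \<Longrightarrow> j \<in> I \<Longrightarrow> i \<noteq> j \<Longrightarrow> S i \<inter> S j = {}"
    and "\<And>i. i \<in> I \<Longrightarrow> ignores (- S i) (f i)"
  shows "av (\<Union>(S ` I)) (\<lambda>\<sigma>. \<Prod>i\<in>I. f i \<sigma>) \<eta> = (\<Prod>i\<in>I. av (S i) (f i) \<eta>)"
  using assms
proof (induction I arbitrary: \<eta> rule: finite_induct)
  case (insert j I)
  define T where "T = \<Union>(S ` I)"
  have fin: "finite (S j)" "finite T" and disj: "S j \<inter> T = {}"
    using insert.prems(1) insert.hyps insert.prems(2)[of j] by (auto simp: T_def)
  have igT: "ignores T (f j)"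
    using insert.prems(3)[of j] disj by (auto intro: ignores_mono)
  have igS: "ignores (S j) (\<lambda>\<sigma>. \<Prod>i\<in>I. av (S i) (f i) \<sigma>)"
  proof (rule ignoresI, rule prod.cong)
    fix \<sigma> \<sigma>' i assume a: "agree_off (S j) \<sigma> \<sigma>'" and i: "i \<in> I"
    have "S j \<subseteq> - S i" using insert.prems(2)[of j i] insert.hyps i by auto
    then have "ignores (S j) (f i)"
      using insert.prems(3)[of i] i by (auto intro: ignores_mono)
    then show "av (S i) (f i) \<sigma>' = av (S i) (f i) \<sigma>"
      using a by (blast intro: ignoresD ignores_av)
  qed simp
  have IH: "av T (\<lambda>\<sigma>. \<Prod>i\<in>I. f i \<sigma>) = (\<lambda>\<sigma>. \<Prod>i\<in>I. av (S i) (f i) \<sigma>)"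
    unfolding T_def by (rule ext, rule insert.IH) (use insert.prems in auto)
  have "av (\<Union>(S ` insert j I)) (\<lambda>\<sigma>. \<Prod>i\<in>insert j I. f i \<sigma>) \<eta>
      = av (S j) (av T (\<lambda>\<sigma>. f j \<sigma> * (\<Prod>i\<in>I. f i \<sigma>))) \<eta>"
    using fin disj insert.hyps by (simp add: T_def[symmetric] av_Un)
  also have "\<dots> = av (S j) (\<lambda>\<sigma>. (\<Prod>i\<in>I. av (S i) (f i) \<sigma>) * f j \<sigma>) \<eta>"
    by (rule av_cong) (simp add: av_mult_ignores[OF igT] IH)
  also have "\<dots> = (\<Prod>i\<in>I. av (S i) (f i) \<eta>) * av (S j) (f j) \<eta>"
    by (rule av_mult_ignores[OF igS])
  finally show ?case using insert.hyps by simp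
qed simp

lemma av_indep_sum:
  assumes "finite I" and "\<And>i. i \<in> I \<Longrightarrow> finite (S i)"
    and "\<And>i j. i \<in> I \<Longrightarrow> j \<in> I \<Longrightarrow> i \<noteq> j \<Longrightarrow> S i \<inter> S j = {}"
    and "\<And>i. i \<in> I \<Longrightarrow> ignores (- S i) (f i)"
  shows "av (\<Union>(S ` I)) (\<lambda>\<sigma>. \<Sum>i\<in>I. f i \<sigma>) \<eta> = (\<Sum>i\<in>I. av (S i) (f i) \<eta>)"
proof -
  have "av (\<Union>(S ` I)) (f i) \<eta> = av (S i) (f i) \<eta>" if "i \<in> I" for i
    using assms(1,2) that
    by (subst av_restrict[of _ "S i"]) (auto intro: ignores_mono[OF assms(4)[OF that]])
  then show ?thesis by (simp add: av_sum)
qed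

lemma var_indep_sum:
  assumes "finite I" and "\<And>i. i \<in> I \<Longrightarrow> finite (S i)"
    and "\<And>i j. i \<in> I \<Longrightarrow> j \<in> I \<Longrightarrow> i \<noteq> j \<Longrightarrow> S i \<inter> S j = {}"
    and "\<And>i. i \<in> I \<Longrightarrow> ignores (- S i) (f i)"
  shows "var (\<Union>(S ` I)) (\<lambda>\<sigma>. \<Sum>i\<in>I. f i \<sigma>) \<eta> = (\<Sum>i\<in>I. var (S i) (f i) \<eta>)"
  using assms
proof (induction I arbitrary: \<eta> rule: finite_induct)
  case empty
  then show ?case by (simp add: var_def)
next
  case (insert j I)
  define T where "T = \<Union>(S ` I)"
  define g where "g \<sigma> = (\<Sum>i\<in>I. f i \<sigma>)" for \<sigma>
  have fin: "finite (S j)" "finite T" and disj: "S j \<inter> T = {}"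
    using insert.prems(1) insert.hyps insert.prems(2)[of j] by (auto simp: T_def)
  have igT: "ignores T (f j)"
    using insert.prems(3)[of j] disj by (auto intro: ignores_mono)
  have ig: "ignores (S j) g"
    unfolding g_def
  proof (rule ignoresI, rule sum.cong)
    fix \<sigma> \<sigma>' i assume a: "agree_off (S j) \<sigma> \<sigma>'" and i: "i \<in> I"
    have "S j \<subseteq> - S i" using insert.prems(2)[of j i] insert.hyps i by auto
    then show "f i \<sigma>' = f i \<sigma>"
      using insert.prems(3)[of i] i a by (auto intro: ignoresD ignores_mono)
  qed simp
  have varT: "var T (\<lambda>\<sigma>. f j \<sigma> + g \<sigma>) \<sigma> = var T g \<sigma>" for \<sigma>
  proof -
    have "var T (\<lambda>\<sigma>. f j \<sigma> + g \<sigma>) \<sigma> = var T (\<lambda>\<tau>. g \<tau> - (- f j \<sigma>)) \<sigma>"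
      by (rule var_cong) (simp add: ignoresD[OF igT])
    then show ?thesis using fin by (simp only: var_shift)
  qed
  have varS: "var (S j) (av T (\<lambda>\<sigma>. f j \<sigma> + g \<sigma>)) \<eta> = var (S j) (f j) \<eta>"
  proof -
    have "av T (\<lambda>\<sigma>. f j \<sigma> + g \<sigma>) = (\<lambda>\<sigma>. f j \<sigma> + av T g \<sigma>)"
      using fin igT by (auto simp: fun_eq_iff av_add av_ignores)
    then have "var (S j) (av T (\<lambda>\<sigma>. f j \<sigma> + g \<sigma>)) \<eta> = var (S j) (\<lambda>\<tau>. f j \<tau> - (- av T g \<eta>)) \<eta>"
      by (simp only:) (rule var_cong, simp add: ignoresD[OF ignores_av[OF ig]])
    then show ?thesis using fin by (simp only: var_shift)
  qed
  have IH: "var T g = (\<lambda>\<sigma>. \<Sum>i\<in>I. var (S i) (f i) \<sigma>)"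
    unfolding T_def g_def by (rule ext, rule insert.IH) (use insert.prems in auto)
  have "var (\<Union>(S ` insert j I)) (\<lambda>\<sigma>. \<Sum>i\<in>insert j I. f i \<sigma>) \<eta>
      = var (S j \<union> T) (\<lambda>\<sigma>. f j \<sigma> + g \<sigma>) \<eta>"
    using insert.hyps by (simp add: T_def g_def)
  also have "\<dots> = av (S j) (var T g) \<eta> + var (S j) (f j) \<eta>"
    using fin disj by (simp add: var_Un varT varS cong: av_cong)
  also have "av (S j) (var T g) = var T g"
    using fin by (intro av_ignores ignores_var[OF ig])
  finally show ?case using insert.hyps by (simp add: IH)
qed

section \<open>Random blocks of sites\<close>

text \<open>
  A block that depends on the configuration but can be recognised without looking inside it. As for stopping
  times, the sites inside keep their law given the block and the configuration outside.
\<close>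
definition stopping :: "(('a \<Rightarrow> bool) \<Rightarrow> 'a set) \<Rightarrow> bool" where
  "stopping G \<longleftrightarrow> (\<forall>\<eta> \<eta>'. agree_off (G \<eta>) \<eta> \<eta>' \<longrightarrow> G \<eta>' = G \<eta>)"

lemma stoppingD: "stopping G \<Longrightarrow> agree_off (G \<eta>) \<eta> \<eta>' \<Longrightarrow> G \<eta>' = G \<eta>"
  by (auto simp: stopping_def)

lemma av_stopping:
  assumes "finite V" and sub: "\<And>\<sigma>. G \<sigma> \<subseteq> V" and stop: "stopping G"
  shows "av V (\<lambda>\<sigma>. av (G \<sigma>) F \<sigma>) \<eta> = av V F \<eta>"
proof -
  define ind where "ind S \<sigma> = (if G \<sigma> = S then 1 else 0 :: real)" for S \<sigma>
  \<comment> \<open>Whether the block equals \<open>S\<close> is decided outside \<open>S\<close>, so this event can be moved out of the average over \<open>S\<close>.\<close>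
  have ig: "ignores S (ind S)" for S
  proof (rule ignoresI)
    fix \<sigma> \<sigma>' assume a: "agree_off S \<sigma> \<sigma>'"
    then have b: "agree_off S \<sigma>' \<sigma>" by (auto simp: agree_off_def)
    show "ind S \<sigma>' = ind S \<sigma>"
      using stoppingD[OF stop, of \<sigma> \<sigma>'] stoppingD[OF stop, of \<sigma>' \<sigma>] a b
      by (auto simp: ind_def)
  qed
  have expand: "(\<Sum>S\<in>Pow V. ind S \<sigma> * g S) = g (G \<sigma>)" for \<sigma> and g :: "'a set \<Rightarrow> real"
  proof -
    have "(\<Sum>S\<in>Pow V. ind S \<sigma> * g S) = (\<Sum>S\<in>Pow V. if G \<sigma> = S then g S else 0)"
      by (rule sum.cong) (auto simp: ind_def)
    then show ?thesis using assms(1) sub[of \<sigma>] by simp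
  qed
  have "av V (\<lambda>\<sigma>. av (G \<sigma>) F \<sigma>) \<eta> = av V (\<lambda>\<sigma>. \<Sum>S\<in>Pow V. av S (\<lambda>\<tau>. ind S \<tau> * F \<tau>) \<sigma>) \<eta>"
    by (simp add: av_mult_ignores[OF ig] expand[of _ "\<lambda>S. av S F _"])
  also have "\<dots> = (\<Sum>S\<in>Pow V. av V (av S (\<lambda>\<tau>. ind S \<tau> * F \<tau>)) \<eta>)"
    by (rule av_sum)
  also have "\<dots> = (\<Sum>S\<in>Pow V. av V (\<lambda>\<tau>. ind S \<tau> * F \<tau>) \<eta>)"
    by (rule sum.cong) (simp_all add: av_av_subset[OF assms(1)])
  also have "\<dots> = av V F \<eta>"
    unfolding av_sum[symmetric] by (simp add: expand[of _ "\<lambda>_. F _"])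
  finally show ?thesis .
qed

end

section \<open>Occupied paths and levels of the tree\<close>

text \<open>
  There is an occupied path of \<open>n\<close> vertices downwards from a child of \<open>x\<close>. The path does not include \<open>x\<close>,
  so the event is independent of the state of \<open>x\<close>.
\<close>
primrec reaches :: "nat \<Rightarrow> nat \<Rightarrow> vertex \<Rightarrow> config \<Rightarrow> bool" where
  "reaches k 0 x \<sigma> = True"
| "reaches k (Suc n) x \<sigma> = (\<exists>i<k. \<sigma> (x @ [i]) \<and> reaches k n (x @ [i]) \<sigma>)"

definition dead :: "nat \<Rightarrow> nat \<Rightarrow> vertex \<Rightarrow> config \<Rightarrow> real" where
  "dead k n x \<sigma> = (if reaches k n x \<sigma> then 0 else 1)"

definition below :: "nat \<Rightarrow> vertex \<Rightarrow> nat \<Rightarrow> vertex set" where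
  "below k x n = {x @ zs |zs. zs \<in> lists {..<k} \<and> zs \<noteq> [] \<and> length zs \<le> n}"

definition levels :: "nat \<Rightarrow> nat \<Rightarrow> nat \<Rightarrow> vertex set" where
  "levels k a b = {x \<in> kary_tree k. a \<le> length x \<and> length x < b}"

lemma below_0 [simp]: "below k x 0 = {}"
  by (auto simp: below_def)

lemma below_Suc: "below k x (Suc n) = (\<Union>i<k. insert (x @ [i]) (below k (x @ [i]) n))"
proof (intro equalityI subsetI)
  fix y assume "y \<in> below k x (Suc n)"
  then obtain zs where zs: "y = x @ zs" "zs \<in> lists {..<k}" "zs \<noteq> []" "length zs \<le> Suc n"
    by (auto simp: below_def)
  then obtain i ws where "zs = i # ws" by (cases zs) auto
  with zs show "y \<in> (\<Union>i<k. insert (x @ [i]) (below k (x @ [i]) n))"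
    by (cases "ws = []") (auto simp: below_def intro!: bexI[of _ i] exI[of _ ws])
next
  fix y assume "y \<in> (\<Union>i<k. insert (x @ [i]) (below k (x @ [i]) n))"
  then obtain i zs where "i < k" "y = x @ i # zs" "zs \<in> lists {..<k}" "length zs \<le> n"
    by (auto simp: below_def)
  then show "y \<in> below k x (Suc n)"
    by (auto simp: below_def intro!: exI[of _ "i # zs"])
qed

lemma finite_below: "finite (below k x n)"
  by (induction n arbitrary: x) (auto simp: below_Suc)

lemma below_mono: "m \<le> n \<Longrightarrow> below k x m \<subseteq> below k x n"
  by (auto simp: below_def)

lemma not_in_below: "length y \<le> length x \<Longrightarrow> y \<notin> below k x n"
  by (auto simp: below_def)

lemma below_disjoint: "length x = length y \<Longrightarrow> x \<noteq> y \<Longrightarrow> below k x m \<inter> below k y n = {}"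
  by (auto simp: below_def)

lemma subtrees_disjoint:
  "i \<noteq> j \<Longrightarrow> insert (x @ [i]) (below k (x @ [i]) n) \<inter> insert (x @ [j]) (below k (x @ [j]) n) = {}"
  using below_disjoint[of "x @ [i]" "x @ [j]" k n n] not_in_below[of "x @ [i]" "x @ [j]" k n]
    not_in_below[of "x @ [j]" "x @ [i]" k n] by auto

lemma ignores_reaches: "ignores (- below k x n) (reaches k n x)"
proof (induction n arbitrary: x)
  case 0
  show ?case by (simp add: ignores_def)
next
  case (Suc n)
  show ?case
  proof (rule ignoresI)
    fix \<sigma> \<sigma>' assume a: "agree_off (- below k x (Suc n)) \<sigma> \<sigma>'"
    have "\<sigma>' (x @ [i]) = \<sigma> (x @ [i])" "reaches k n (x @ [i]) \<sigma>' = reaches k n (x @ [i]) \<sigma>" if "i < k" for i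
    proof -
      show "\<sigma>' (x @ [i]) = \<sigma> (x @ [i])"
        using a that by (auto simp: agree_off_def below_Suc)
      show "reaches k n (x @ [i]) \<sigma>' = reaches k n (x @ [i]) \<sigma>"
        by (rule ignoresD[OF Suc.IH]) (use a that in \<open>auto simp: agree_off_def below_Suc\<close>)
    qed
    then show "reaches k (Suc n) x \<sigma>' = reaches k (Suc n) x \<sigma>" by auto
  qed
qed

lemma ignores_dead: "ignores (- below k x n) (dead k n x)"
  using ignores_reaches[of k x n] unfolding dead_def ignores_def by simp

lemma finite_levels: "finite (levels k a b)"
proof -
  have "levels k a b \<subseteq> {xs. set xs \<subseteq> {..<k} \<and> length xs \<le> b}"
    by (auto simp: levels_def kary_tree_def)
  then show ?thesis by (rule finite_subset) (simp add: finite_lists_length_le)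
qed

lemma levels_split: "a \<le> c \<Longrightarrow> c \<le> b \<Longrightarrow> levels k a c \<union> levels k c b = levels k a b"
  by (auto simp: levels_def)

lemma levels_disjoint: "levels k a c \<inter> levels k c b = {}"
  by (auto simp: levels_def)

lemma levels_below:
  assumes "i < b"
  shows "(\<Union>x\<in>levels k i (Suc i). below k x (b - 1 - i)) = levels k (Suc i) b"
proof (intro equalityI subsetI)
  fix y assume "y \<in> levels k (Suc i) b"
  then have y: "y \<in> lists {..<k}" "Suc i \<le> length y" "length y < b"
    by (auto simp: levels_def kary_tree_def)
  have "take i y \<in> levels k i (Suc i)"
    using y by (auto simp: levels_def kary_tree_def dest: in_set_takeD)
  moreover have "y \<in> below k (take i y) (b - 1 - i)"
    unfolding below_def
    by (rule CollectI, rule exI[of _ "drop i y"]) (use y in \<open>auto dest: in_set_dropD\<close>)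
  ultimately show "y \<in> (\<Union>x\<in>levels k i (Suc i). below k x (b - 1 - i))" by blast
next
  fix y assume "y \<in> (\<Union>x\<in>levels k i (Suc i). below k x (b - 1 - i))"
  then show "y \<in> levels k (Suc i) b"
    using assms by (auto simp: levels_def below_def kary_tree_def neq_Nil_conv)
qed

section \<open>Extinction of the critical branching process\<close>

text \<open>
  For fixed \<open>m s\<close> the power \<open>(1 - s) ^ m\<close> increases with \<open>m\<close>, so it is smallest in the binary case
  \<open>m = 2\<close>. This is what makes the exponent of the upper bound independent of the degree of the tree.
\<close>
lemma quadratic_lower_bound_power:
  fixes s :: real
  assumes "2 \<le> m" "0 \<le> s" "real m * s \<le> 1"
  shows "(1 - real m * s / 2)\<^sup>2 \<le> (1 - s) ^ m"
  using assms
proof (induction m rule: dec_induct)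
  case base
  then show ?case by simp
next
  case (step m)
  define a where "a = real m * s / 2"
  have m: "2 \<le> real m" using step.hyps by simp
  have ms: "real m * s + s \<le> 1" using step.prems by (simp add: algebra_simps)
  then have s: "s \<le> 1 / 2" and a: "a \<le> 1 / 2" "0 \<le> a"
    using m step.prems mult_right_mono[OF m, of s] by (auto simp: a_def)
  have "(1 - real (Suc m) * s / 2)\<^sup>2 = ((1 - a) - s / 2)\<^sup>2"
    by (rule arg_cong[where f = "\<lambda>t. t\<^sup>2"]) (simp add: a_def field_simps)
  also have "\<dots> = (1 - s) * (1 - a)\<^sup>2 + s * (s / 4 - a * (1 - a))"
    by (simp add: power2_eq_square algebra_simps)
  also have "\<dots> \<le> (1 - s) * (1 - a)\<^sup>2"
  proof -
    have "s / 4 \<le> a / 2" using m step.prems mult_right_mono[OF m, of s] by (simp add: a_def)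
    also have "a / 2 \<le> a * (1 - a)" using a mult_left_mono[of "1/2" "1 - a" a] by simp
    finally show ?thesis using step.prems(1) by (simp add: mult_nonneg_nonpos)
  qed
  also have "\<dots> \<le> (1 - s) * (1 - s) ^ m"
    using step s ms unfolding a_def by (intro mult_left_mono step.IH) auto
  finally show ?case by simp
qed

locale critical_tree = bernoulli_sites p for p :: real +
  fixes k :: nat
  assumes k_ge_2: "2 \<le> k" and p_critical: "p = 1 / real k"
begin

text \<open>The recursion of the generating function of the binomial offspring law, see \<open>av_dead\<close>.\<close>
fun extinction :: "nat \<Rightarrow> real" where
  "extinction 0 = 0"
| "extinction (Suc n) = (1 - p * (1 - extinction n)) ^ k"

lemma av_dead: "av (below k x n) (dead k n x) \<eta> = extinction n"
proof (induction n arbitrary: x \<eta>)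
  case 0
  show ?case by (simp add: dead_def)
next
  case (Suc n)
  define S where "S i = insert (x @ [i]) (below k (x @ [i]) n)" for i
  define g where "g i \<sigma> = 1 - (if \<sigma> (x @ [i]) then 1 - dead k n (x @ [i]) \<sigma> else 0)" for i \<sigma>
  have dead: "dead k (Suc n) x = (\<lambda>\<sigma>. \<Prod>i<k. g i \<sigma>)"
  proof
    fix \<sigma>
    show "dead k (Suc n) x \<sigma> = (\<Prod>i<k. g i \<sigma>)"
    proof (cases "reaches k (Suc n) x \<sigma>")
      case True
      then obtain i where "i < k" "g i \<sigma> = 0" by (auto simp: g_def dead_def)
      then have "(\<Prod>i<k. g i \<sigma>) = 0" by (intro prod_zero) auto
      then show ?thesis using True by (simp add: dead_def del: reaches.simps)
    next
      case False
      then have "g i \<sigma> = 1" if "i < k" for i using that by (auto simp: g_def dead_def)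
      then show ?thesis using False by (simp add: dead_def del: reaches.simps)
    qed
  qed
  have ig: "ignores (- S i) (g i)" for i
  proof (rule ignoresI)
    fix \<sigma> \<sigma>' assume a: "agree_off (- S i) \<sigma> \<sigma>'"
    have "dead k n (x @ [i]) \<sigma>' = dead k n (x @ [i]) \<sigma>"
      by (rule ignoresD[OF ignores_dead]) (use a in \<open>auto simp: agree_off_def S_def\<close>)
    then show "g i \<sigma>' = g i \<sigma>" using a by (auto simp: g_def agree_off_def S_def)
  qed
  have one: "av (S i) (g i) \<eta> = 1 - p * (1 - extinction n)" for i
  proof -
    have ni: "x @ [i] \<notin> below k (x @ [i]) n" by (simp add: not_in_below)
    have up: "av (below k (x @ [i]) n) (g i) (\<eta>(x @ [i] := b)) = (if b then extinction n else 1)" for b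
    proof -
      have "av (below k (x @ [i]) n) (g i) (\<eta>(x @ [i] := b))
        = av (below k (x @ [i]) n) (if b then dead k n (x @ [i]) else (\<lambda>_. 1)) (\<eta>(x @ [i] := b))"
        by (rule av_cong) (use ni in \<open>auto simp: g_def agree_off_def\<close>)
      then show ?thesis using Suc.IH by (simp add: finite_below)
    qed
    show ?thesis
      unfolding S_def by (simp add: av_insert[OF finite_below ni] up algebra_simps)
  qed
  have "av (\<Union>(S ` {..<k})) (\<lambda>\<sigma>. \<Prod>i<k. g i \<sigma>) \<eta> = (\<Prod>i<k. av (S i) (g i) \<eta>)"
    by (rule av_prod) (use ig subtrees_disjoint in \<open>auto simp: S_def finite_below\<close>)
  moreover have "\<Union>(S ` {..<k}) = below k x (Suc n)" by (simp add: below_Suc S_def)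
  ultimately show ?case by (simp add: dead one)
qed

lemma extinction_le_1: "extinction n \<le> 1"
proof -
  have "av (below k [] n) (dead k n []) (\<lambda>_. False) \<le> av (below k [] n) (\<lambda>_. 1) (\<lambda>_. False)"
    by (rule av_mono) (simp add: dead_def)
  then show ?thesis by (simp add: av_dead finite_below)
qed

text \<open>
  By \<open>quadratic_lower_bound_power\<close> the survival probabilities \<open>t\<close>, \<open>t'\<close> of successive generations satisfy
  \<open>t' \<le> t - t\<^sup>2 / 4\<close>, and \<open>4 / (n + 4)\<close> is a supersolution of this recursion that starts at one.
\<close>
lemma extinction_lower_bound: "real n / (real n + 4) \<le> extinction n"
proof (induction n)
  case (Suc n)
  define t where "t = 1 - extinction n"
  have t: "0 \<le> t" "t \<le> 4 / (real n + 4)" "t \<le> 1"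
  proof -
    have "1 - real n / (real n + 4) = 4 / (real n + 4)" by (simp add: field_simps)
    then show "t \<le> 4 / (real n + 4)" using Suc.IH by (simp add: t_def)
    also have "\<dots> \<le> 1" by simp
    finally show "t \<le> 1" .
  qed (simp add: t_def extinction_le_1)
  have k: "0 < real k" using k_ge_2 by simp
  have "real (Suc n) / (real (Suc n) + 4) \<le> ((real n + 2) / (real n + 4))\<^sup>2"
    by (simp add: power_divide divide_simps power2_eq_square) (simp add: algebra_simps)
  also have "(real n + 2) / (real n + 4) = 1 - (4 / (real n + 4)) / 2"
    by (simp add: field_simps)
  also have "(1 - (4 / (real n + 4)) / 2)\<^sup>2 \<le> (1 - t / 2)\<^sup>2"
    by (rule power_mono) (use t in \<open>auto simp: field_simps\<close>)
  also have "\<dots> = (1 - real k * (p * t) / 2)\<^sup>2"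
    using k by (simp add: p_critical)
  also have "\<dots> \<le> (1 - p * t) ^ k"
    using t k by (intro quadratic_lower_bound_power k_ge_2) (simp_all add: p_critical)
  finally show ?case by (simp add: t_def)
qed simp

lemma extinction_nonneg: "0 \<le> extinction n"
  using extinction_lower_bound[of n] by (rule order_trans[rotated]) simp

text \<open>
  The product of the fractions \<open>n / (n + 4)\<close> telescopes down to four factors \<open>(m - h + i) / (m + i)\<close>,
  and each of them is at least one half because \<open>2 h \<le> m + i\<close>.
\<close>
lemma prod_extinction_lower_bound:
  assumes "h \<le> m" "2 * h \<le> m + 1"
  shows "1 / 16 \<le> (\<Prod>j<h. extinction (m - j))"
proof -
  define r where "r i h = (real (m - h) + i) / (real m + i)" for i :: real and h
  have "r 1 h * r 2 h * r 3 h * r 4 h \<le> (\<Prod>j<h. real (m - j) / (real (m - j) + 4))"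
    using assms(1)
  proof (induction h)
    case (Suc h)
    define d where "d = real (m - Suc h)"
    have d: "real (m - h) = d + 1" "0 \<le> d" using Suc.prems by (auto simp: d_def of_nat_diff)
    have new: "r i (Suc h) = (d + i) / (real m + i)" for i
      by (simp add: r_def d_def[symmetric])
    have old: "r 1 h = (d + 2) / (real m + 1)" "r 2 h = (d + 3) / (real m + 2)"
        "r 3 h = (d + 4) / (real m + 3)" "r 4 h = (d + 5) / (real m + 4)"
      by (simp_all add: r_def d)
    have "u1 / s1 * (u2 / s2) * (u3 / s3) * (u4 / s4)
        = u2 / s1 * (u3 / s2) * (u4 / s3) * (u5 / s4) * (u1 / u5)"
      if "u5 \<noteq> 0" for u1 u2 u3 u4 u5 s1 s2 s3 s4 :: real
      using that by (simp add: mult_ac)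
    from this[of "d + 5"] have "r 1 (Suc h) * r 2 (Suc h) * r 3 (Suc h) * r 4 (Suc h)
        = r 1 h * r 2 h * r 3 h * r 4 h * ((d + 1) / (d + 5))"
      unfolding new old using d(2) by simp
    also have "\<dots> \<le> (\<Prod>j<h. real (m - j) / (real (m - j) + 4)) * ((d + 1) / (d + 5))"
      using Suc d(2) by (intro mult_right_mono) auto
    finally show ?case by (simp add: d add.commute)
  qed (simp add: r_def)
  moreover have "1 / 2 \<le> r i h" if "1 \<le> i" for i
    using assms that by (simp add: r_def field_simps of_nat_diff)
  then have "(1 / 2) * (1 / 2) * (1 / 2) * (1 / 2) \<le> r 1 h * r 2 h * r 3 h * r 4 h"
    by (intro mult_mono mult_nonneg_nonneg) (simp_all add: r_def)
  moreover have "(\<Prod>j<h. real (m - j) / (real (m - j) + 4)) \<le> (\<Prod>j<h. extinction (m - j))"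
    by (rule prod_mono) (simp add: extinction_lower_bound)
  ultimately show ?thesis by simp
qed

section \<open>Poincare inequalities\<close>
definition dirichlet :: "vertex set \<Rightarrow> (config \<Rightarrow> real) \<Rightarrow> config \<Rightarrow> real" where
  "dirichlet V f \<eta> = (\<Sum>y\<in>V. av V (\<lambda>\<sigma>. constraint k V y \<sigma> * var {y} f \<sigma>) \<eta>)"

text \<open>
  The inequality is demanded for every configuration outside \<open>V\<close>, so it can be integrated over
  the outside; the constraints do not see the outside.
\<close>
definition poincare :: "vertex set \<Rightarrow> real \<Rightarrow> bool" where
  "poincare V C \<longleftrightarrow> (\<forall>f \<eta>. var V f \<eta> \<le> C * dirichlet V f \<eta>)"

lemma constraint_nonneg: "0 \<le> constraint k V y \<sigma>"
  by (simp add: constraint_def)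

lemma constraint_antimono: "G \<subseteq> V \<Longrightarrow> constraint k V y \<sigma> \<le> constraint k G y \<sigma>"
  by (auto simp: constraint_def)

lemma ignores_constraint: "ignores (- (children k y \<inter> V)) (constraint k V y)"
  by (auto simp: ignores_def constraint_def agree_off_def)

lemma dirichlet_nonneg: "0 \<le> dirichlet V f \<eta>"
  unfolding dirichlet_def
  by (intro sum_nonneg av_nonneg mult_nonneg_nonneg constraint_nonneg var_nonneg) simp

lemma poincare_mono:
  assumes "poincare V C" "C \<le> C'"
  shows "poincare V C'"
  using assms mult_right_mono[OF assms(2) dirichlet_nonneg] unfolding poincare_def
  by (meson order_trans)

text \<open>
  A function that only looks at \<open>G\<close> is a test function for \<open>V\<close>, and it moves more easily in \<open>G\<close>
  alone because fewer children have to be empty.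
\<close>
lemma poincare_subset:
  assumes "finite V" "G \<subseteq> V" "0 \<le> C" "poincare V C"
  shows "poincare G C"
  unfolding poincare_def
proof (intro allI)
  fix f :: "config \<Rightarrow> real" and \<eta> :: config
  \<comment> \<open>Outside \<open>G\<close> the sites are frozen in the state given by \<open>\<eta>\<close>.\<close>
  define f' where "f' \<sigma> = f (\<lambda>v. if v \<in> G then \<sigma> v else \<eta> v)" for \<sigma>
  have finG: "finite G" using assms finite_subset by blast
  have f': "f' \<sigma> = f \<sigma>" if "agree_off G \<eta> \<sigma>" for \<sigma>
    using that by (auto simp: f'_def agree_off_def intro!: arg_cong[where f = f])
  have ig: "ignores (- G) f'"
    by (auto simp: ignores_def f'_def agree_off_def intro!: arg_cong[where f = f])
  have igV: "ignores (V - G) f'" by (rule ignores_mono[OF ig]) auto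
  have "var G f \<eta> = var G f' \<eta>" by (rule var_cong) (simp add: f')
  also have "\<dots> = var V f' \<eta>" using var_restrict[OF assms(1,2) igV] by simp
  also have "\<dots> \<le> C * dirichlet V f' \<eta>" using assms(4) by (simp add: poincare_def)
  also have "\<dots> \<le> C * dirichlet G f \<eta>"
  proof (rule mult_left_mono[OF _ assms(3)])
    have zero: "av V (\<lambda>\<sigma>. constraint k V y \<sigma> * var {y} f' \<sigma>) \<eta> = 0" if "y \<in> V - G" for y
    proof -
      have "ignores {y} f'" by (rule ignores_mono[OF ig]) (use that in auto)
      then show ?thesis using assms(1) by (simp add: var_ignores)
    qed
    have le: "av V (\<lambda>\<sigma>. constraint k V y \<sigma> * var {y} f' \<sigma>) \<eta>
        \<le> av G (\<lambda>\<sigma>. constraint k G y \<sigma> * var {y} f \<sigma>) \<eta>" if y: "y \<in> G" for y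
    proof -
      have "av V (\<lambda>\<sigma>. constraint k V y \<sigma> * var {y} f' \<sigma>) \<eta>
          \<le> av V (\<lambda>\<sigma>. constraint k G y \<sigma> * var {y} f' \<sigma>) \<eta>"
        using assms(2) by (intro av_mono mult_right_mono constraint_antimono var_nonneg) auto
      also have "\<dots> = av G (\<lambda>\<sigma>. constraint k G y \<sigma> * var {y} f' \<sigma>) \<eta>"
      proof -
        have "ignores (V - G) (constraint k G y)"
          by (rule ignores_mono[OF ignores_constraint]) auto
        then have "ignores (V - G) (\<lambda>\<sigma>. constraint k G y \<sigma> * var {y} f' \<sigma>)"
          by (rule ignores_comp2) (rule ignores_var[OF igV])
        then show ?thesis by (simp add: av_restrict[OF assms(1,2)])
      qed
      also have "\<dots> = av G (\<lambda>\<sigma>. constraint k G y \<sigma> * var {y} f \<sigma>) \<eta>"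
      proof (rule av_cong)
        fix \<sigma> assume a: "agree_off G \<eta> \<sigma>"
        have "var {y} f' \<sigma> = var {y} f \<sigma>"
        proof (rule var_cong)
          fix \<tau> assume "agree_off {y} \<sigma> \<tau>"
          then have "agree_off G \<eta> \<tau>"
            using a y by (auto intro: agree_off_trans agree_off_mono)
          then show "f' \<tau> = f \<tau>" by (rule f')
        qed
        then show "constraint k G y \<sigma> * var {y} f' \<sigma> = constraint k G y \<sigma> * var {y} f \<sigma>"
          by simp
      qed
      finally show ?thesis .
    qed
    have "dirichlet V f' \<eta> = (\<Sum>y\<in>G. av V (\<lambda>\<sigma>. constraint k V y \<sigma> * var {y} f' \<sigma>) \<eta>)"
      unfolding dirichlet_def using assms(1,2) zero by (intro sum.mono_neutral_right) auto
    also have "\<dots> \<le> dirichlet G f \<eta>"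
      unfolding dirichlet_def by (rule sum_mono) (rule le)
    finally show "dirichlet V f' \<eta> \<le> dirichlet G f \<eta>" .
  qed
  finally show "var G f \<eta> \<le> C * dirichlet G f \<eta>" .
qed

text \<open>
  Conditionally on a stopping block the sites inside have their original law, so the deviation of \<open>f\<close> from its
  average over the block is controlled by the inequality for the block. Since the children outside the block
  are empty, the constraints of the block agree with those of \<open>V\<close>.
\<close>
lemma poincare_random_block:
  assumes fin: "finite V" and sub: "\<And>\<sigma>. G \<sigma> \<subseteq> V" and stop: "stopping G"
    and poin: "\<And>\<sigma>. poincare (G \<sigma>) C"
    and bdry: "\<And>\<sigma> y z. y \<in> G \<sigma> \<Longrightarrow> z \<in> children k y \<inter> V \<Longrightarrow> z \<notin> G \<sigma> \<Longrightarrow> \<not> \<sigma> z"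
    and C: "0 \<le> C"
  shows "av V (\<lambda>\<sigma>. (f \<sigma> - av (G \<sigma>) f \<sigma>)\<^sup>2) \<eta> \<le> C * dirichlet V f \<eta>"
proof -
  have finG: "finite (G \<sigma>)" for \<sigma> using sub[of \<sigma>] fin finite_subset by blast
  define H where "H \<tau> = (\<Sum>y\<in>G \<tau>. constraint k (G \<tau>) y \<tau> * var {y} f \<tau>)" for \<tau>
  have "av V (\<lambda>\<sigma>. (f \<sigma> - av (G \<sigma>) f \<sigma>)\<^sup>2) \<eta>
      = av V (\<lambda>\<sigma>. av (G \<sigma>) (\<lambda>\<tau>. (f \<tau> - av (G \<tau>) f \<tau>)\<^sup>2) \<sigma>) \<eta>"
    by (rule av_stopping[OF fin sub stop, symmetric])
  also have "\<dots> \<le> av V (\<lambda>\<sigma>. C * av (G \<sigma>) H \<sigma>) \<eta>"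
  proof (rule av_mono)
    fix \<sigma>
    have "av (G \<sigma>) (\<lambda>\<tau>. (f \<tau> - av (G \<tau>) f \<tau>)\<^sup>2) \<sigma> = var (G \<sigma>) f \<sigma>"
      unfolding var_eq[OF finG] by (rule av_cong) (simp add: stoppingD[OF stop] av_agree)
    also have "\<dots> \<le> C * dirichlet (G \<sigma>) f \<sigma>"
      using poin by (simp add: poincare_def)
    also have "dirichlet (G \<sigma>) f \<sigma> = av (G \<sigma>) H \<sigma>"
      unfolding dirichlet_def av_sum[symmetric] H_def
      by (rule av_cong) (simp add: stoppingD[OF stop])
    finally show "av (G \<sigma>) (\<lambda>\<tau>. (f \<tau> - av (G \<tau>) f \<tau>)\<^sup>2) \<sigma> \<le> C * av (G \<sigma>) H \<sigma>" .
  qed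
  also have "\<dots> = C * av V H \<eta>"
    by (simp add: av_cmult av_stopping[OF fin sub stop])
  also have "\<dots> \<le> C * dirichlet V f \<eta>"
    unfolding dirichlet_def av_sum[symmetric]
  proof (intro mult_left_mono[OF _ C] av_mono)
    fix \<tau>
    have "constraint k (G \<tau>) y \<tau> \<le> constraint k V y \<tau>" if "y \<in> G \<tau>" for y
      using bdry[OF that] by (auto simp: constraint_def)
    then have "H \<tau> \<le> (\<Sum>y\<in>G \<tau>. constraint k V y \<tau> * var {y} f \<tau>)"
      unfolding H_def by (intro sum_mono mult_right_mono var_nonneg) auto
    also have "\<dots> \<le> (\<Sum>y\<in>V. constraint k V y \<tau> * var {y} f \<tau>)"
      by (intro sum_mono2 fin sub mult_nonneg_nonneg constraint_nonneg var_nonneg) simp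
    finally show "H \<tau> \<le> (\<Sum>y\<in>V. constraint k V y \<tau> * var {y} f \<tau>)" .
  qed
  finally show ?thesis .
qed

section \<open>Bisection of the depth\<close>

text \<open>
  Whether \<open>y\<close> is shielded depends only on vertices strictly below \<open>y\<close>. This is what allows \<open>y\<close> to be
  resampled while the set of shielded vertices is known.
\<close>
definition shielded :: "nat \<Rightarrow> nat \<Rightarrow> config \<Rightarrow> vertex set" where
  "shielded a M \<sigma> = {y \<in> levels k a M. \<not> reaches k (M - length y) y \<sigma>}"

text \<open>
  Shielded vertices lie on no occupied path to level \<open>M\<close>, whatever their own state is. So changing them
  neither creates nor destroys such paths.
\<close>
lemma stopping_shielded: "stopping (shielded a M)"
  unfolding stopping_def
proof (intro allI impI)
  fix \<sigma> \<sigma>' assume ag: "agree_off (shielded a M \<sigma>) \<sigma> \<sigma>'"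
  have "reaches k d y \<sigma>' = reaches k d y \<sigma>"
    if "y \<in> kary_tree k" "a \<le> length y" "length y + d = M" for d y
    using that
  proof (induction d arbitrary: y)
    case (Suc d)
    have "(\<sigma>' (y @ [i]) \<and> reaches k d (y @ [i]) \<sigma>') = (\<sigma> (y @ [i]) \<and> reaches k d (y @ [i]) \<sigma>)"
      if i: "i < k" for i
    proof -
      have *: "y @ [i] \<in> kary_tree k" "a \<le> length (y @ [i])" "length (y @ [i]) + d = M"
        using Suc.prems i by (auto simp: kary_tree_def)
      then have IH: "reaches k d (y @ [i]) \<sigma>' = reaches k d (y @ [i]) \<sigma>"
        by (rule Suc.IH)
      show ?thesis
      proof (cases "y @ [i] \<in> shielded a M \<sigma>")
        case True
        then have "\<not> reaches k d (y @ [i]) \<sigma>" using * by (auto simp: shielded_def)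
        then show ?thesis using IH by simp
      next
        case False
        then show ?thesis using IH ag by (simp add: agree_off_def)
      qed
    qed
    then show ?case by auto
  qed simp
  then show "shielded a M \<sigma>' = shielded a M \<sigma>"
    by (auto simp: shielded_def levels_def)
qed

text \<open>An occupied child that is connected to level \<open>M\<close>, or lies on it, would connect its parent.\<close>
lemma shielded_boundary:
  assumes "y \<in> shielded a M \<sigma>" "z \<in> children k y" "z \<notin> shielded a M \<sigma>"
  shows "\<not> \<sigma> z"
proof -
  obtain i where z: "z = y @ [i]" "i < k" using assms(2) by (auto simp: children_def)
  have y: "y \<in> kary_tree k" "a \<le> length y" "length y < M" "\<not> reaches k (M - length y) y \<sigma>"
    using assms(1) by (auto simp: shielded_def levels_def)
  define d where "d = M - length z"
  have d: "M - length y = Suc d" using y z by (simp add: d_def)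
  have n: "\<not> (\<sigma> z \<and> reaches k d z \<sigma>)" using y(4) z unfolding d by auto
  have "z \<in> kary_tree k" "a \<le> length z" using y z by (auto simp: kary_tree_def)
  then have "reaches k d z \<sigma>"
    using assms(3) by (cases "length z < M") (auto simp: shielded_def levels_def d_def)
  then show ?thesis using n by simp
qed

text \<open>If \<open>x\<close> is shielded, its state is averaged out and does not influence the block.\<close>
lemma shielded_average_erasure:
  assumes "x \<in> levels k a M"
  shows "ignores {x} (\<lambda>\<sigma>. dead k (M - length x) x \<sigma> * av (shielded a M \<sigma>) f \<sigma>)"
proof (rule ignoresI)
  fix \<sigma> \<sigma>' assume ag: "agree_off {x} \<sigma> \<sigma>'"
  have "ignores {x} (dead k (M - length x) x)"
    by (rule ignores_mono[OF ignores_dead]) (use not_in_below in auto)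
  then have d: "dead k (M - length x) x \<sigma>' = dead k (M - length x) x \<sigma>"
    using ag by (rule ignoresD)
  show "dead k (M - length x) x \<sigma>' * av (shielded a M \<sigma>') f \<sigma>'
      = dead k (M - length x) x \<sigma> * av (shielded a M \<sigma>) f \<sigma>"
  proof (cases "reaches k (M - length x) x \<sigma>")
    case True
    then show ?thesis using d by (simp add: dead_def)
  next
    case False
    then have "agree_off (shielded a M \<sigma>) \<sigma> \<sigma>'"
      using assms ag by (auto simp: shielded_def intro: agree_off_mono)
    then have "av (shielded a M \<sigma>') f \<sigma>' = av (shielded a M \<sigma>) f \<sigma>"
      using stoppingD[OF stopping_shielded] av_agree by metis
    then show ?thesis using d by simp
  qed
qed

lemma var_levels_step:
  assumes "i \<le> M" "M < b"
    and N: "\<And>x. x \<in> levels k i (Suc i) \<Longrightarrow> ignores {x} (\<lambda>\<sigma>. dead k (M - i) x \<sigma> * N \<sigma>)"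
  shows "extinction (M - i) * var (levels k i b) N \<eta>
    \<le> av (levels k i (Suc i)) (var (levels k (Suc i) b) N) \<eta>"
proof -
  define W where "W x = below k x (b - 1 - i)" for x
  have len: "length x = i" if "x \<in> levels k i (Suc i)" for x
    using that by (simp add: levels_def)
  have W: "\<Union>(W ` levels k i (Suc i)) = levels k (Suc i) b"
    unfolding W_def using assms by (intro levels_below) auto
  have sub: "below k x (M - i) \<subseteq> W x" for x
    unfolding W_def using assms by (intro below_mono) auto
  have "extinction (M - i) * var (levels k i (Suc i) \<union> \<Union>(W ` levels k i (Suc i))) N \<eta>
    \<le> av (levels k i (Suc i)) (var (\<Union>(W ` levels k i (Suc i))) N) \<eta>"
  proof (rule var_erasure_level[where c = "dead k (M - i)"])
    fix x assume x: "x \<in> levels k i (Suc i)"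
    show "finite (W x)" by (simp add: W_def finite_below)
    show "W x \<inter> levels k i (Suc i) = {}"
      using not_in_below[of _ x] len x by (fastforce simp: W_def)
    show "ignores (- W x) (dead k (M - i) x)"
      by (rule ignores_mono[OF ignores_dead]) (use sub in auto)
    show "extinction (M - i) \<le> av (W x) (dead k (M - i) x) \<sigma>" for \<sigma>
    proof -
      have "av (W x) (dead k (M - i) x) = av (below k x (M - i)) (dead k (M - i) x)"
        using sub by (intro av_restrict ignores_mono[OF ignores_dead]) (auto simp: W_def finite_below)
      then show ?thesis by (simp add: av_dead)
    qed
    fix y assume "y \<in> levels k i (Suc i)" "x \<noteq> y"
    then show "W x \<inter> W y = {}" unfolding W_def using x len by (intro below_disjoint) auto
  qed (use N extinction_nonneg finite_levels in \<open>auto simp: dead_def\<close>)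
  moreover have "levels k i (Suc i) \<union> levels k (Suc i) b = levels k i b"
    using assms by (intro levels_split) auto
  ultimately show ?thesis by (simp add: W)
qed

text \<open>
  Levels are revealed from the top; revealing one level leaves at least the extinction probability times
  the conditional variance that was there before.
\<close>
lemma var_levels:
  assumes "a + h \<le> M" "M < b"
    and N: "\<And>x. x \<in> levels k a M \<Longrightarrow> ignores {x} (\<lambda>\<sigma>. dead k (M - length x) x \<sigma> * N \<sigma>)"
  shows "(\<Prod>j<h. extinction (M - a - j)) * var (levels k a b) N \<eta>
    \<le> av (levels k a (a + h)) (var (levels k (a + h) b) N) \<eta>"
  using assms(1)
proof (induction h)
  case 0
  have "levels k a a = {}" by (auto simp: levels_def)
  then show ?case by simp
next
  case (Suc h)
  let ?e = "extinction (M - a - h)"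
  have "(\<Prod>j<Suc h. extinction (M - a - j)) * var (levels k a b) N \<eta>
      = ?e * ((\<Prod>j<h. extinction (M - a - j)) * var (levels k a b) N \<eta>)" by simp
  also have "\<dots> \<le> ?e * av (levels k a (a + h)) (var (levels k (a + h) b) N) \<eta>"
    using Suc by (intro mult_left_mono extinction_nonneg) auto
  also have "\<dots> = av (levels k a (a + h)) (\<lambda>\<sigma>. ?e * var (levels k (a + h) b) N \<sigma>) \<eta>"
    by (rule av_cmult[symmetric])
  also have "\<dots> \<le> av (levels k a (a + h))
      (av (levels k (a + h) (Suc (a + h))) (var (levels k (Suc (a + h)) b) N)) \<eta>"
  proof (rule av_mono)
    fix \<sigma>
    have "ignores {x} (\<lambda>\<sigma>. dead k (M - (a + h)) x \<sigma> * N \<sigma>)"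
      if "x \<in> levels k (a + h) (Suc (a + h))" for x
      using N[of x] that Suc.prems by (auto simp: levels_def less_Suc_eq_le)
    then show "?e * var (levels k (a + h) b) N \<sigma>
      \<le> av (levels k (a + h) (Suc (a + h))) (var (levels k (Suc (a + h)) b) N) \<sigma>"
      using var_levels_step[of "a + h" M b N \<sigma>] Suc.prems assms(2) by simp
  qed
  also have "\<dots> = av (levels k a (a + Suc h)) (var (levels k (a + Suc h) b) N) \<eta>"
    using av_Un[OF finite_levels finite_levels levels_disjoint, of k a "a + h" "Suc (a + h)"]
      levels_split[of a "a + h" "Suc (a + h)" k] by simp
  finally show ?case .
qed

text \<open>The lower part of a slab is closed under children, so it has the constraints of the whole slab.\<close>
lemma dirichlet_lower_levels:
  assumes "a \<le> c" "c \<le> b" "0 \<le> C" "poincare (levels k c b) C"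
  shows "av (levels k a c) (var (levels k c b) f) \<eta> \<le> C * dirichlet (levels k a b) f \<eta>"
proof -
  let ?V = "levels k a b" and ?B = "levels k c b"
  have V: "levels k a c \<union> ?B = ?V" using assms by (intro levels_split)
  have "av (levels k a c) (var ?B f) \<eta> \<le> av (levels k a c) (\<lambda>\<sigma>. C * dirichlet ?B f \<sigma>) \<eta>"
    using assms(4) by (intro av_mono) (simp add: poincare_def)
  also have "\<dots> = C * (\<Sum>y\<in>?B. av (levels k a c) (av ?B (\<lambda>\<sigma>. constraint k ?B y \<sigma> * var {y} f \<sigma>)) \<eta>)"
    unfolding dirichlet_def av_cmult av_sum ..
  also have "\<dots> = C * (\<Sum>y\<in>?B. av ?V (\<lambda>\<sigma>. constraint k ?B y \<sigma> * var {y} f \<sigma>) \<eta>)"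
    using av_Un[OF finite_levels finite_levels levels_disjoint, of k a c b] V by simp
  also have "\<dots> = C * (\<Sum>y\<in>?B. av ?V (\<lambda>\<sigma>. constraint k ?V y \<sigma> * var {y} f \<sigma>) \<eta>)"
  proof -
    have "children k y \<inter> ?B = children k y \<inter> ?V" if "y \<in> ?B" for y
      using that assms(1) by (auto simp: levels_def children_def)
    then show ?thesis by (simp add: constraint_def)
  qed
  also have "\<dots> \<le> C * dirichlet ?V f \<eta>"
    unfolding dirichlet_def using V
    by (intro mult_left_mono[OF _ assms(3)] sum_mono2 finite_levels av_nonneg mult_nonneg_nonneg
        constraint_nonneg var_nonneg) auto
  finally show ?thesis .
qed

text \<open>
  The function \<open>f\<close> is compared with its average \<open>N\<close> over the shielded vertices. The error \<open>f - N\<close> is paid by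
  the random block, and the variance of \<open>N\<close> is at most \<open>16\<close> times its variance in the lower levels.
  There \<open>N\<close> is replaced by \<open>f\<close> again. The constant is \<open>130 = 2 \<cdot> 16 \<cdot> (2 + 2) + 2\<close>.
\<close>
lemma poincare_bisection:
  assumes "1 \<le> h" "2 * h \<le> l" "3 * h \<le> l + 1" "0 \<le> C"
    and IH: "\<And>a. poincare (levels k a (a + (l - h))) C"
  shows "poincare (levels k a (a + l)) (130 * C)"
  unfolding poincare_def
proof (intro allI)
  fix f :: "config \<Rightarrow> real" and \<eta> :: config
  define M b where "M = a + (l - h)" and "b = a + l"
  define G where "G = shielded a M"
  define N where "N \<sigma> = av (G \<sigma>) f \<sigma>" for \<sigma>
  let ?V = "levels k a b" and ?T = "levels k a (a + h)" and ?B = "levels k (a + h) b"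
  have Mb: "M < b" "a + h \<le> M" using assms by (auto simp: M_def b_def)
  have GM: "G \<sigma> \<subseteq> levels k a M" for \<sigma> by (auto simp: G_def shielded_def)
  have GV: "G \<sigma> \<subseteq> ?V" for \<sigma> using Mb by (auto simp: G_def shielded_def levels_def)
  have "poincare (levels k a M) C" unfolding M_def by (rule IH)
  then have poinG: "poincare (G \<sigma>) C" for \<sigma>
    using poincare_subset[OF finite_levels GM assms(4)] by blast
  define A D where "A = av ?V (\<lambda>\<sigma>. (f \<sigma> - N \<sigma>)\<^sup>2) \<eta>" and "D = C * dirichlet ?V f \<eta>"
  have A: "A \<le> D"
    unfolding A_def D_def N_def
  proof (rule poincare_random_block[OF finite_levels GV _ poinG _ assms(4)])
    show "stopping G" unfolding G_def by (rule stopping_shielded)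
    show "\<not> \<sigma> z" if "y \<in> G \<sigma>" "z \<in> children k y \<inter> ?V" "z \<notin> G \<sigma>" for \<sigma> y z
      using that shielded_boundary unfolding G_def by blast
  qed
  have low: "av ?T (var ?B f) \<eta> \<le> D"
    unfolding D_def
  proof (rule dirichlet_lower_levels)
    show "poincare ?B C"
      using IH[of "a + h"] assms by (simp add: b_def)
  qed (use Mb assms in auto)
  have N: "(1 / 16) * var ?V N \<eta> \<le> av ?T (var ?B N) \<eta>"
  proof -
    have "(1 / 16) * var ?V N \<eta> \<le> (\<Prod>j<h. extinction (M - a - j)) * var ?V N \<eta>"
      using prod_extinction_lower_bound[of h "l - h"] assms
      by (intro mult_right_mono var_nonneg finite_levels) (auto simp: M_def)
    also have "\<dots> \<le> av ?T (var ?B N) \<eta>"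
      unfolding N_def G_def by (rule var_levels[OF Mb(2,1) shielded_average_erasure])
    finally show ?thesis .
  qed
  have "av ?T (var ?B N) \<eta> \<le> av ?T (\<lambda>\<sigma>. 2 * var ?B f \<sigma> + 2 * av ?B (\<lambda>\<tau>. (f \<tau> - N \<tau>)\<^sup>2) \<sigma>) \<eta>"
  proof (rule av_mono)
    fix \<sigma>
    have "var ?B N \<sigma> = var ?B (\<lambda>\<tau>. f \<tau> + (N \<tau> - f \<tau>)) \<sigma>" by simp
    also have "\<dots> \<le> 2 * var ?B f \<sigma> + 2 * var ?B (\<lambda>\<tau>. N \<tau> - f \<tau>) \<sigma>"
      by (rule var_add_le[OF finite_levels])
    also have "var ?B (\<lambda>\<tau>. N \<tau> - f \<tau>) \<sigma> \<le> av ?B (\<lambda>\<tau>. (f \<tau> - N \<tau>)\<^sup>2) \<sigma>"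
      using var_le_square[OF finite_levels, where c = 0] by (simp add: power2_commute)
    finally show "var ?B N \<sigma> \<le> 2 * var ?B f \<sigma> + 2 * av ?B (\<lambda>\<tau>. (f \<tau> - N \<tau>)\<^sup>2) \<sigma>" by simp
  qed
  also have "\<dots> = 2 * av ?T (var ?B f) \<eta> + 2 * A"
    using av_Un[OF finite_levels finite_levels levels_disjoint, of k a "a + h" b]
      levels_split[of a "a + h" b k] Mb by (simp add: A_def av_add av_cmult)
  finally have TB: "av ?T (var ?B N) \<eta> \<le> 2 * D + 2 * D"
    using A low by simp
  have "var ?V f \<eta> = var ?V (\<lambda>\<sigma>. N \<sigma> + (f \<sigma> - N \<sigma>)) \<eta>" by simp
  also have "\<dots> \<le> 2 * var ?V N \<eta> + 2 * var ?V (\<lambda>\<sigma>. f \<sigma> - N \<sigma>) \<eta>"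
    by (rule var_add_le[OF finite_levels])
  also have "var ?V (\<lambda>\<sigma>. f \<sigma> - N \<sigma>) \<eta> \<le> A"
    unfolding A_def using var_le_square[OF finite_levels, where c = 0] by simp
  finally have "var ?V f \<eta> \<le> 130 * D"
    using N TB A by linarith
  then show "var (levels k a (a + l)) f \<eta> \<le> 130 * C * dirichlet (levels k a (a + l)) f \<eta>"
    by (simp add: D_def b_def)
qed

text \<open>
  One bisection replaces \<open>l\<close> by at most \<open>5 l / 6\<close> levels, and \<open>27\<close> is the least integer exponent with
  \<open>130 \<cdot> (5 / 6) ^ 27 \<le> 1\<close>.
\<close>
theorem poincare_levels:
  assumes "1 \<le> l"
  shows "poincare (levels k a (a + l)) (real l ^ 27)"
  using assms
proof (induction l arbitrary: a rule: less_induct)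
  case (less l)
  show ?case
  proof (cases "l = 1")
    case True
    have "constraint k (levels k a (Suc a)) y \<sigma> = 1" if "y \<in> levels k a (Suc a)" for y \<sigma>
      using that by (auto simp: constraint_def children_def levels_def)
    then have "dirichlet (levels k a (Suc a)) f \<eta>
        = (\<Sum>y\<in>levels k a (Suc a). av (levels k a (Suc a)) (var {y} f) \<eta>)" for f \<eta>
      by (simp add: dirichlet_def)
    then show ?thesis
      using True by (simp add: poincare_def var_le_sum_var[OF finite_levels])
  next
    case False
    define h where "h = (l + 1) div 3"
    have h: "1 \<le> h" "2 * h \<le> l" "3 * h \<le> l + 1" "6 * (l - h) \<le> 5 * l" "1 \<le> l - h" "l - h < l"
      using False less.prems by (auto simp: h_def)
    have "poincare (levels k a (a + (l - h))) (real (l - h) ^ 27)" for a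
      by (rule less.IH) (use h in auto)
    then have "poincare (levels k a (a + l)) (130 * real (l - h) ^ 27)"
      using h by (intro poincare_bisection[of h]) auto
    moreover have "130 * real (l - h) ^ 27 \<le> real l ^ 27"
    proof -
      have small: "(5 / 6) ^ 27 \<le> (1 / 130 :: real)" by (simp add: power_divide)
      have "real (l - h) \<le> (5 / 6) * real l" using h(4) by linarith
      then have "real (l - h) ^ 27 \<le> ((5 / 6) * real l) ^ 27" by (intro power_mono) auto
      also have "\<dots> = (5 / 6) ^ 27 * real l ^ 27" by (rule power_mult_distrib)
      also have "\<dots> \<le> (1 / 130) * real l ^ 27"
        by (rule mult_right_mono[OF small]) simp
      finally show ?thesis by simp
    qed
    ultimately show ?thesis by (rule poincare_mono)
  qed
qed

end

section \<open>Spectral gap and Dirichlet form\<close>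
lemma agree_off_configs: "configs T = {\<sigma>. agree_off T (\<lambda>_. False) \<sigma>}"
  by (auto simp: configs_def PiE_dflt_def agree_off_def)

lemma finite_tree_levels: "finite_tree k L = levels k 0 (0 + (L + 1))"
  by (auto simp: finite_tree_def levels_def depth_def)

context bernoulli_sites
begin

lemma expectation_tree_measure:
  assumes "finite T"
  shows "measure_pmf.expectation (tree_measure p T) f = av T f (\<lambda>_. False)"
  using assms
proof (induction T arbitrary: f rule: finite_induct)
  case empty
  then show ?case by (simp add: tree_measure_def)
next
  case (insert x T)
  have ins: "tree_measure p (insert x T)
      = bernoulli_pmf p \<bind> (\<lambda>b. map_pmf (\<lambda>\<sigma>. \<sigma>(x := b)) (tree_measure p T))"
    unfolding tree_measure_def site_measure_def
    using insert by (subst Pi_pmf_insert') (simp_all add: map_pmf_def)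
  have fin: "finite (set_pmf (tree_measure p T))"
    unfolding tree_measure_def using insert.hyps
    by (subst set_Pi_pmf) (auto intro!: finite_PiE_dflt)
  have upd: "av T (\<lambda>\<sigma>. f (\<sigma>(x := b))) (\<lambda>_. False) = av T f ((\<lambda>_. False)(x := b))" for b
  proof -
    have "(override T A (\<lambda>_. False))(x := b) = override T A ((\<lambda>_. False)(x := b))" for A
      using insert.hyps by (auto simp: override_def)
    then show ?thesis by (simp add: av_def)
  qed
  have "measure_pmf.expectation (tree_measure p (insert x T)) f
      = (\<Sum>b\<in>UNIV. pmf (bernoulli_pmf p) b * av T f ((\<lambda>_. False)(x := b)))"
    unfolding ins using fin
    by (subst pmf_expectation_bind[of UNIV]) (simp_all add: insert.IH upd)
  then show ?case
    using p_pos p_less_1 by (simp add: UNIV_bool av_insert[OF insert.hyps])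
qed

lemma variance_tree_measure:
  assumes "finite T"
  shows "measure_pmf.variance (tree_measure p T) f = var T f (\<lambda>_. False)"
  using assms by (simp add: expectation_tree_measure var_eq)

text \<open>The constraint at \<open>y\<close> does not depend on the state of \<open>y\<close>, so it factors out of the average over \<open>y\<close>.\<close>
lemma expectation_generator:
  assumes "finite T"
  shows "measure_pmf.expectation (tree_measure p T) (\<lambda>\<sigma>. f \<sigma> * (- generator k p T f \<sigma>))
    = (\<Sum>y\<in>T. av T (\<lambda>\<sigma>. constraint k T y \<sigma> * var {y} f \<sigma>) (\<lambda>_. False))"
proof -
  have "av T (\<lambda>\<sigma>. f \<sigma> * (- generator k p T f \<sigma>)) \<eta>
      = av T (\<lambda>\<sigma>. \<Sum>y\<in>T. constraint k T y \<sigma> * ((f \<sigma>)\<^sup>2 - av {y} f \<sigma> * f \<sigma>)) \<eta>" for \<eta>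
  proof (rule av_cong)
    fix \<sigma>
    have "f \<sigma> * (- generator k p T f \<sigma>)
        = (\<Sum>y\<in>T. f \<sigma> * (- (constraint k T y \<sigma> * (av {y} f \<sigma> - f \<sigma>))))"
      by (simp only: generator_def av_site_average sum_negf[symmetric] sum_distrib_left)
    also have "\<dots> = (\<Sum>y\<in>T. constraint k T y \<sigma> * ((f \<sigma>)\<^sup>2 - av {y} f \<sigma> * f \<sigma>))"
      by (rule sum.cong) (simp_all add: power2_eq_square algebra_simps)
    finally show "f \<sigma> * (- generator k p T f \<sigma>)
        = (\<Sum>y\<in>T. constraint k T y \<sigma> * ((f \<sigma>)\<^sup>2 - av {y} f \<sigma> * f \<sigma>))" .
  qed
  also have "av T (\<lambda>\<sigma>. \<Sum>y\<in>T. constraint k T y \<sigma> * ((f \<sigma>)\<^sup>2 - av {y} f \<sigma> * f \<sigma>)) \<eta>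
      = (\<Sum>y\<in>T. av T (\<lambda>\<sigma>. constraint k T y \<sigma> * var {y} f \<sigma>) \<eta>)" for \<eta>
    unfolding av_sum
  proof (rule sum.cong)
    fix y assume y: "y \<in> T"
    have ig: "ignores {y} (constraint k T y)"
      by (auto simp: ignores_def constraint_def children_def agree_off_def)
    have site: "av {y} (\<lambda>\<sigma>. constraint k T y \<sigma> * ((f \<sigma>)\<^sup>2 - av {y} f \<sigma> * f \<sigma>))
        = (\<lambda>\<sigma>. constraint k T y \<sigma> * var {y} f \<sigma>)"
      by (rule ext)
        (simp only: av_mult_ignores[OF ig] av_diff av_mult_ignores[OF ignores_av_self] var_def
          power2_eq_square)
    have "av T (av {y} g) = av T g" for g
      by (rule av_av_subset) (use assms y in auto)
    from fun_cong[OF this, of "\<lambda>\<sigma>. constraint k T y \<sigma> * ((f \<sigma>)\<^sup>2 - av {y} f \<sigma> * f \<sigma>)" \<eta>]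
    show "av T (\<lambda>\<sigma>. constraint k T y \<sigma> * ((f \<sigma>)\<^sup>2 - av {y} f \<sigma> * f \<sigma>)) \<eta>
        = av T (\<lambda>\<sigma>. constraint k T y \<sigma> * var {y} f \<sigma>) \<eta>"
      unfolding site by (rule sym)
  qed simp
  finally show ?thesis unfolding expectation_tree_measure[OF assms] .
qed

text \<open>
  All configurations have positive weight. Therefore no test function of the spectral gap has variance
  zero, for which the quotient would be zero by convention.
\<close>
lemma var_pos_iff:
  assumes "finite T"
  shows "0 < var T f (\<lambda>_. False) \<longleftrightarrow> \<not> f constant_on configs T"
proof
  assume pos: "0 < var T f (\<lambda>_. False)"
  show "\<not> f constant_on configs T"
  proof
    assume "f constant_on configs T"
    then obtain c where "\<And>\<sigma>. agree_off T (\<lambda>_. False) \<sigma> \<Longrightarrow> f \<sigma> = c"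
      by (auto simp: constant_on_def agree_off_configs)
    then have "var T f (\<lambda>_. False) = var T (\<lambda>_. c) (\<lambda>_. False)"
      by (rule var_cong)
    then show False using pos assms by (simp add: var_def)
  qed
next
  assume nc: "\<not> f constant_on configs T"
  define m where "m = av T f (\<lambda>_. False)"
  show "0 < var T f (\<lambda>_. False)"
  proof (rule ccontr)
    assume "\<not> 0 < var T f (\<lambda>_. False)"
    then have "av T (\<lambda>\<sigma>. (f \<sigma> - m)\<^sup>2) (\<lambda>_. False) = 0"
      using var_nonneg[OF assms, of f "\<lambda>_. False"] by (simp add: var_eq assms m_def)
    then have "\<forall>A\<in>Pow T. weight T A * (f (override T A (\<lambda>_. False)) - m)\<^sup>2 = 0"
      unfolding av_def
      by (rule sum_nonneg_eq_0_iff[THEN iffD1, rotated 2])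
        (simp_all add: assms order_less_imp_le[OF weight_pos])
    then have zero: "f (override T A (\<lambda>_. False)) = m" if "A \<in> Pow T" for A
      using that weight_pos[of T A] by (metis eq_iff_diff_eq_0 less_irrefl mult_eq_0_iff power_eq_0_iff)
    have "f \<sigma> = m" if "agree_off T (\<lambda>_. False) \<sigma>" for \<sigma>
    proof -
      have "override T {v \<in> T. \<sigma> v} (\<lambda>_. False) = \<sigma>"
        using that by (auto simp: override_def agree_off_def)
      then show ?thesis using zero[of "{v \<in> T. \<sigma> v}"] by auto
    qed
    then show False using nc by (auto simp: constant_on_def agree_off_configs)
  qed
qed

lemma var_single: "var {x} f \<sigma> = p * (1 - p) * (f (\<sigma>(x := True)) - f (\<sigma>(x := False)))\<^sup>2"
proof -
  have "p * u\<^sup>2 + (1 - p) * v\<^sup>2 - (p * u + (1 - p) * v)\<^sup>2 = p * (1 - p) * (u - v)\<^sup>2" for u v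
    by algebra
  then show ?thesis unfolding var_def av_single .
qed

end

context critical_tree
begin

lemma p_times_k: "real k * p = 1"
  using k_ge_2 by (simp add: p_critical)

lemma spectral_gap_eq:
  assumes "finite T"
  shows "spectral_gap k p T = (INF f \<in> {f. \<not> f constant_on configs T}.
    dirichlet T f (\<lambda>_. False) / var T f (\<lambda>_. False))"
  unfolding spectral_gap_def dirichlet_def
  by (simp only: expectation_generator[OF assms] variance_tree_measure[OF assms])

lemma spectral_gap_le:
  assumes "finite T" "0 < var T f (\<lambda>_. False)"
  shows "spectral_gap k p T \<le> dirichlet T f (\<lambda>_. False) / var T f (\<lambda>_. False)"
  unfolding spectral_gap_eq[OF assms(1)]
proof (rule cINF_lower)
  show "bdd_below ((\<lambda>f. dirichlet T f (\<lambda>_. False) / var T f (\<lambda>_. False)) ` {f. \<not> f constant_on configs T})"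
    by (rule bdd_belowI2[of _ 0])
      (auto intro!: divide_nonneg_nonneg dirichlet_nonneg var_nonneg assms)
qed (use assms var_pos_iff in auto)

lemma spectral_gap_ge:
  assumes "finite T" "T \<noteq> {}" "poincare T C" "0 < C"
  shows "1 / C \<le> spectral_gap k p T"
  unfolding spectral_gap_eq[OF assms(1)]
proof (rule cINF_greatest)
  obtain x where x: "x \<in> T" using assms(2) by blast
  have "(\<lambda>\<sigma>. of_bool (\<sigma> x) :: real) \<in> {f. \<not> f constant_on configs T}"
  proof -
    have mem: "(\<lambda>_. False) \<in> configs T" "(\<lambda>_. False)(x := True) \<in> configs T"
      using x by (auto simp: agree_off_configs agree_off_def)
    have "\<not> (\<lambda>\<sigma>. of_bool (\<sigma> x) :: real) constant_on configs T"
    proof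
      assume "(\<lambda>\<sigma>. of_bool (\<sigma> x) :: real) constant_on configs T"
      then obtain c :: real where c: "\<And>\<sigma>. \<sigma> \<in> configs T \<Longrightarrow> of_bool (\<sigma> x) = c"
        unfolding constant_on_def by blast
      show False using c[OF mem(1)] c[OF mem(2)] by simp
    qed
    then show ?thesis by simp
  qed
  then show "{f :: config \<Rightarrow> real. \<not> f constant_on configs T} \<noteq> {}" by blast
next
  fix f :: "config \<Rightarrow> real" assume "f \<in> {f. \<not> f constant_on configs T}"
  then have "0 < var T f (\<lambda>_. False)" using var_pos_iff[OF assms(1)] by simp
  moreover have "var T f (\<lambda>_. False) \<le> C * dirichlet T f (\<lambda>_. False)"
    using assms(3) by (simp add: poincare_def)
  ultimately show "1 / C \<le> dirichlet T f (\<lambda>_. False) / var T f (\<lambda>_. False)"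
    using assms(4) by (simp add: field_simps)
qed

end

section \<open>The occupied cluster of the root\<close>

text \<open>
  The size of the occupied cluster of \<open>x\<close> in the tree of depth \<open>n\<close> below \<open>x\<close>, where \<open>x\<close> counts as well
  and an empty \<open>x\<close> has an empty cluster.
\<close>
primrec cluster :: "nat \<Rightarrow> nat \<Rightarrow> vertex \<Rightarrow> config \<Rightarrow> real" where
  "cluster k 0 x \<sigma> = of_bool (\<sigma> x)"
| "cluster k (Suc n) x \<sigma> = of_bool (\<sigma> x) * (1 + (\<Sum>i<k. cluster k n (x @ [i]) \<sigma>))"

lemma ignores_cluster: "ignores (- insert x (below k x n)) (cluster k n x)"
proof (induction n arbitrary: x)
  case 0
  show ?case by (auto simp: ignores_def agree_off_def)
next
  case (Suc n)
  show ?case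
  proof (rule ignoresI)
    fix \<sigma> \<sigma>' assume a: "agree_off (- insert x (below k x (Suc n))) \<sigma> \<sigma>'"
    have "cluster k n (x @ [i]) \<sigma>' = cluster k n (x @ [i]) \<sigma>" if "i < k" for i
      by (rule ignoresD[OF Suc.IH]) (use a that in \<open>auto simp: agree_off_def below_Suc\<close>)
    moreover have "\<sigma>' x = \<sigma> x" using a by (simp add: agree_off_def)
    ultimately show "cluster k (Suc n) x \<sigma>' = cluster k (Suc n) x \<sigma>" by simp
  qed
qed

lemma cluster_upd_other:
  assumes "y \<notin> insert x (below k x n)"
  shows "cluster k n x (\<sigma>(y := b)) = cluster k n x \<sigma>"
  by (rule ignoresD[OF ignores_cluster]) (use assms in \<open>auto simp: agree_off_def\<close>)

text \<open>
  A vertex whose children are empty is a leaf of the cluster or not in it. So flipping it changes the size by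
  one if its proper ancestors are occupied, and not at all otherwise.
\<close>
lemma cluster_flip:
  assumes "zs \<in> lists {..<k}" "length zs \<le> n"
    and "\<And>i. i < k \<Longrightarrow> length zs < n \<Longrightarrow> \<not> \<sigma> (x @ zs @ [i])"
  shows "cluster k n x (\<sigma>(x @ zs := True)) - cluster k n x (\<sigma>(x @ zs := False))
    = (\<Prod>j<length zs. of_bool (\<sigma> (x @ take j zs)))"
  using assms
proof (induction n arbitrary: x zs)
  case 0
  then show ?case by simp
next
  case (Suc n)
  show ?case
  proof (cases zs)
    case Nil
    have "cluster k n (x @ [i]) (\<sigma>(x := True)) = 0" if "i < k" for i
      using Suc.prems(3)[OF that] Nil by (cases n) auto
    then have none: "(\<Sum>i<k. cluster k n (x @ [i]) (\<sigma>(x := True))) = 0"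
      by (intro sum.neutral) auto
    show ?thesis unfolding Nil append_Nil2 cluster.simps none by simp
  next
    case (Cons i ws)
    have i: "i < k" and ws: "ws \<in> lists {..<k}" "length ws \<le> n"
      using Suc.prems Cons by auto
    let ?y = "x @ zs"
    have y: "?y = (x @ [i]) @ ws" "?y \<noteq> x" using Cons by auto
    have other: "cluster k n (x @ [j]) (\<sigma>(?y := b)) = cluster k n (x @ [j]) \<sigma>" if "j \<noteq> i" for j b
      using that Cons by (intro cluster_upd_other) (auto simp: below_def)
    have rest: "(\<Sum>j<k. cluster k n (x @ [j]) (\<sigma>(?y := b)))
        = cluster k n (x @ [i]) (\<sigma>(?y := b)) + (\<Sum>j\<in>{..<k} - {i}. cluster k n (x @ [j]) \<sigma>)" for b
      using i other by (subst sum.remove[of _ i]) auto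
    have IH: "cluster k n (x @ [i]) (\<sigma>((x @ [i]) @ ws := True))
          - cluster k n (x @ [i]) (\<sigma>((x @ [i]) @ ws := False))
        = (\<Prod>j<length ws. of_bool (\<sigma> ((x @ [i]) @ take j ws)))"
      by (rule Suc.IH) (use ws Suc.prems(3) Cons in auto)
    have "cluster k (Suc n) x (\<sigma>(?y := True)) - cluster k (Suc n) x (\<sigma>(?y := False))
        = of_bool (\<sigma> x) * (cluster k n (x @ [i]) (\<sigma>(?y := True)) - cluster k n (x @ [i]) (\<sigma>(?y := False)))"
      using y(2) by (simp only: cluster.simps rest) (simp add: algebra_simps)
    also have "\<dots> = (\<Prod>j<length zs. of_bool (\<sigma> (x @ take j zs)))"
      unfolding IH[folded y(1)] by (simp add: Cons prod.lessThan_Suc_shift del: prod.lessThan_Suc)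
    finally show ?thesis .
  qed
qed

context critical_tree
begin

lemma av_children:
  "av (below k x (Suc n)) (\<lambda>\<sigma>. \<Sum>i<k. cluster k n (x @ [i]) \<sigma>) \<eta>
    = (\<Sum>i<k. av (insert (x @ [i]) (below k (x @ [i]) n)) (cluster k n (x @ [i])) \<eta>)"
  unfolding below_Suc
  by (rule av_indep_sum) (use subtrees_disjoint ignores_cluster in \<open>auto simp: finite_below\<close>)

lemma var_children:
  "var (below k x (Suc n)) (\<lambda>\<sigma>. \<Sum>i<k. cluster k n (x @ [i]) \<sigma>) \<eta>
    = (\<Sum>i<k. var (insert (x @ [i]) (below k (x @ [i]) n)) (cluster k n (x @ [i])) \<eta>)"
  unfolding below_Suc
  by (rule var_indep_sum) (use subtrees_disjoint ignores_cluster in \<open>auto simp: finite_below\<close>)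

text \<open>An empty root has an empty cluster. Used for the first and second moments, \<open>r = 0\<close> and \<open>r = 1\<close>.\<close>
lemma av_cluster_power:
  fixes r :: nat
  shows "av (insert x (below k x (Suc n))) (\<lambda>\<sigma>. (cluster k (Suc n) x \<sigma>) ^ Suc r) \<eta>
    = p * av (below k x (Suc n)) (\<lambda>\<sigma>. (1 + (\<Sum>i<k. cluster k n (x @ [i]) \<sigma>)) ^ Suc r) (\<eta>(x := True))"
proof -
  have nx: "x \<notin> below k x (Suc n)" by (simp add: not_in_below)
  have "av (below k x (Suc n)) (\<lambda>\<sigma>. (cluster k (Suc n) x \<sigma>) ^ Suc r) (\<eta>(x := b))
    = av (below k x (Suc n)) 
        (if b then \<lambda>\<sigma>. (1 + (\<Sum>i<k. cluster k n (x @ [i]) \<sigma>)) ^ Suc r else (\<lambda>_. 0)) (\<eta>(x := b))" for b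
    by (rule av_cong) (use nx in \<open>auto simp: agree_off_def\<close>)
  then show ?thesis using nx by (simp add: av_insert finite_below del: power_Suc cluster.simps)
qed

lemma av_cluster: "av (insert x (below k x n)) (cluster k n x) \<eta> = p * (real n + 1)"
proof (induction n arbitrary: x \<eta>)
  case 0
  show ?case by (simp add: av_single)
next
  case (Suc n)
  show ?case
    using av_cluster_power[of x n 0 \<eta>] p_times_k
    by (simp add: av_add av_children Suc.IH finite_below algebra_simps del: cluster.simps)
qed

text \<open>
  The subtrees of the children are independent, and \<open>k p = 1\<close>. So their clusters contribute the
  variance of a tree of depth \<open>n\<close>, and the state of the root, multiplying a quantity of mean \<open>n + 2\<close>, adds
  \<open>p (1 - p) (n + 2)\<^sup>2\<close>. The sum of these squares grows like a cube.
\<close>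
lemma var_cluster: "p * (1 - p) * ((real n + 1) ^ 3 / 3) \<le> var (insert x (below k x n)) (cluster k n x) \<eta>"
proof (induction n arbitrary: x \<eta>)
  case 0
  have v: "var {x} (cluster k 0 x) \<eta> = p * (1 - p)" by (simp add: var_single)
  show ?case unfolding below_0 v using p_pos p_less_1 by simp
next
  case (Suc n)
  let ?B = "below k x (Suc n)"
  let ?\<sigma> = "\<eta>(x := True)"
  define Y where "Y \<sigma> = (\<Sum>i<k. cluster k n (x @ [i]) \<sigma>)" for \<sigma>
  have EY: "av ?B Y ?\<sigma> = real n + 1"
    unfolding Y_def by (simp add: av_children av_cluster p_times_k flip: mult.assoc)
  have VY: "p * (1 - p) * ((real n + 1) ^ 3 / 3) \<le> p * var ?B Y ?\<sigma>"
  proof -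
    have "(\<Sum>i<k. p * (1 - p) * ((real n + 1) ^ 3 / 3)) \<le> var ?B Y ?\<sigma>"
      unfolding Y_def var_children by (rule sum_mono) (rule Suc.IH)
    then have "p * (\<Sum>i<k. p * (1 - p) * ((real n + 1) ^ 3 / 3)) \<le> p * var ?B Y ?\<sigma>"
      using p_pos by simp
    moreover have "p * (\<Sum>i<k. z) = z" for z :: real
    proof -
      have "p * (\<Sum>i<k. z) = (real k * p) * z" by simp
      then show ?thesis by (simp only: p_times_k mult_1)
    qed
    ultimately show ?thesis by (simp only:)
  qed
  have "av ?B (\<lambda>\<sigma>. (1 + Y \<sigma>)\<^sup>2) ?\<sigma> = var ?B Y ?\<sigma> + (real n + 2)\<^sup>2"
  proof -
    have "var ?B (\<lambda>\<sigma>. Y \<sigma> - (- 1)) ?\<sigma> = var ?B Y ?\<sigma>"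
      by (rule var_shift) (rule finite_below)
    then show ?thesis
      by (simp add: var_def av_add finite_below EY add.commute)
  qed
  then have sq: "av (insert x ?B) (\<lambda>\<sigma>. (cluster k (Suc n) x \<sigma>)\<^sup>2) \<eta> = p * (var ?B Y ?\<sigma> + (real n + 2)\<^sup>2)"
    using av_cluster_power[of x n 1 \<eta>] by (simp add: Y_def numeral_2_eq_2 del: cluster.simps)
  have "var (insert x ?B) (cluster k (Suc n) x) \<eta>
      = p * var ?B Y ?\<sigma> + p * (1 - p) * (real n + 2)\<^sup>2"
    unfolding var_def[of "insert x ?B"] sq av_cluster by (simp add: power2_eq_square algebra_simps)
  moreover have "p * (1 - p) * ((real (Suc n) + 1) ^ 3 / 3)
      \<le> p * (1 - p) * ((real n + 1) ^ 3 / 3) + p * (1 - p) * (real n + 2)\<^sup>2"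
  proof -
    have "(real (Suc n) + 1) ^ 3 / 3 \<le> (real n + 1) ^ 3 / 3 + (real n + 2)\<^sup>2"
      by (simp add: power3_eq_cube power2_eq_square field_simps)
    then have "p * (1 - p) * ((real (Suc n) + 1) ^ 3 / 3)
      \<le> p * (1 - p) * ((real n + 1) ^ 3 / 3 + (real n + 2)\<^sup>2)"
      using p_pos p_less_1 by (intro mult_left_mono) auto
    then show ?thesis by (simp only: distrib_left)
  qed
  ultimately show ?case using VY by linarith
qed

lemma av_path:
  assumes "finite V" "\<And>j. j < length y \<Longrightarrow> take j y \<in> V"
  shows "av V (\<lambda>\<sigma>. \<Prod>j<length y. of_bool (\<sigma> (take j y))) \<eta> = p ^ length y"
proof -
  define S where "S j = {take j y}" for j
  have dis: "S i \<inter> S j = {}" if "i < length y" "j < length y" "i \<noteq> j" for i j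
  proof -
    have "length (take i y) \<noteq> length (take j y)" using that by simp
    then have "take i y \<noteq> take j y" by metis
    then show ?thesis by (simp add: S_def)
  qed
  have ig: "ignores (V - \<Union>(S ` {..<length y})) (\<lambda>\<sigma>. \<Prod>j<length y. of_bool (\<sigma> (take j y)) :: real)"
    by (rule ignoresI, rule prod.cong) (auto simp: agree_off_def S_def)
  have "av V (\<lambda>\<sigma>. \<Prod>j<length y. of_bool (\<sigma> (take j y))) \<eta>
      = av (\<Union>(S ` {..<length y})) (\<lambda>\<sigma>. \<Prod>j<length y. of_bool (\<sigma> (take j y))) \<eta>"
    using assms ig by (subst av_restrict[of V "\<Union>(S ` {..<length y})"]) (auto simp: S_def)
  also have "\<dots> = (\<Prod>j<length y. av (S j) (\<lambda>\<sigma>. of_bool (\<sigma> (take j y))) \<eta>)"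
    by (rule av_prod) (use dis in \<open>auto simp: S_def ignores_def agree_off_def\<close>)
  also have "\<dots> = p ^ length y"
    by (simp add: S_def av_single)
  finally show ?thesis .
qed

lemma sum_levels:
  fixes g :: "nat \<Rightarrow> real"
  shows "(\<Sum>y\<in>levels k 0 b. g (length y)) = (\<Sum>j<b. real k ^ j * g j)"
proof -
  define X where "X j = {y. set y \<subseteq> {..<k} \<and> length y = j}" for j
  have "levels k 0 b = (\<Union>j<b. X j)"
    by (auto simp: levels_def kary_tree_def X_def)
  then have "(\<Sum>y\<in>levels k 0 b. g (length y)) = (\<Sum>j<b. \<Sum>y\<in>X j. g (length y))"
    by (simp add: sum.UNION_disjoint X_def finite_lists_length_eq disjoint_iff)
  also have "\<dots> = (\<Sum>j<b. real k ^ j * g j)"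
  proof (rule sum.cong)
    fix j
    have "(\<Sum>y\<in>X j. g (length y)) = (\<Sum>y\<in>X j. g j)"
      by (rule sum.cong) (auto simp: X_def)
    then show "(\<Sum>y\<in>X j. g (length y)) = real k ^ j * g j"
      by (simp add: X_def card_lists_length_eq)
  qed simp
  finally show ?thesis .
qed

text \<open>
  A legal flip at depth \<open>d\<close> costs at most \<open>p (1 - p)\<close> and matters with probability \<open>p\<^sup>d\<close>, while there are
  \<open>k\<^sup>d\<close> vertices at that depth: every level contributes the same amount.
\<close>
lemma dirichlet_cluster:
  "dirichlet (levels k 0 (Suc L)) (cluster k L []) \<eta> \<le> p * (1 - p) * (real L + 1)"
proof -
  let ?V = "levels k 0 (Suc L)"
  have flip: "constraint k ?V y \<sigma> * var {y} (cluster k L []) \<sigma>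
      \<le> p * (1 - p) * (\<Prod>j<length y. of_bool (\<sigma> (take j y)))" if y: "y \<in> ?V" for y \<sigma>
  proof (cases "\<forall>z\<in>children k y \<inter> ?V. \<sigma> z = False")
    case True
    have "\<not> \<sigma> ([] @ y @ [i])" if "i < k" "length y < L" for i
    proof -
      have "y @ [i] \<in> children k y \<inter> ?V"
        using that y by (auto simp: children_def levels_def kary_tree_def)
      then show ?thesis using True by auto
    qed
    then have "cluster k L [] (\<sigma>(y := True)) - cluster k L [] (\<sigma>(y := False))
        = (\<Prod>j<length y. of_bool (\<sigma> (take j y)))"
      using y cluster_flip[of y k L \<sigma> "[]"] by (simp add: levels_def kary_tree_def)
    moreover have "(\<Prod>j<length y. of_bool (\<sigma> (take j y)))\<^sup>2 = (\<Prod>j<length y. of_bool (\<sigma> (take j y)) :: real)"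
      unfolding prod_power_distrib by (rule prod.cong) auto
    ultimately show ?thesis using True by (simp add: constraint_def var_single)
  next
    case False
    have "0 \<le> p * (1 - p) * (\<Prod>j<length y. of_bool (\<sigma> (take j y)))"
      using p_pos p_less_1 by (intro mult_nonneg_nonneg prod_nonneg) auto
    then show ?thesis using False by (auto simp: constraint_def)
  qed
  have "dirichlet ?V (cluster k L []) \<eta>
      \<le> (\<Sum>y\<in>?V. av ?V (\<lambda>\<sigma>. p * (1 - p) * (\<Prod>j<length y. of_bool (\<sigma> (take j y)))) \<eta>)"
    unfolding dirichlet_def by (intro sum_mono av_mono flip)
  also have "\<dots> = (\<Sum>y\<in>?V. p * (1 - p) * p ^ length y)"
  proof (rule sum.cong)
    fix y assume "y \<in> ?V"
    then have "take j y \<in> ?V" for j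
      by (auto simp: levels_def kary_tree_def dest: in_set_takeD)
    then show "av ?V (\<lambda>\<sigma>. p * (1 - p) * (\<Prod>j<length y. of_bool (\<sigma> (take j y)))) \<eta>
        = p * (1 - p) * p ^ length y"
      by (simp only: av_cmult av_path[OF finite_levels])
  qed simp
  also have "\<dots> = (\<Sum>j<Suc L. real k ^ j * (p * (1 - p) * p ^ j))"
    by (rule sum_levels)
  also have "\<dots> = (\<Sum>j<Suc L. p * (1 - p))"
  proof (rule sum.cong)
    fix j
    have "real k ^ j * (p * (1 - p) * p ^ j) = (p * (1 - p)) * (real k * p) ^ j"
      by (simp add: power_mult_distrib)
    then show "real k ^ j * (p * (1 - p) * p ^ j) = p * (1 - p)" by (simp add: p_times_k)
  qed simp
  finally show ?thesis by (simp add: algebra_simps)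
qed

lemma relaxation_time_bounds:
  assumes "1 \<le> L"
  shows "(real L + 1)\<^sup>2 / 3 \<le> relaxation_time k p (finite_tree k L)"
    and "relaxation_time k p (finite_tree k L) \<le> (real L + 1) ^ 27"
proof -
  let ?T = "finite_tree k L" and ?o = "\<lambda>_ :: vertex. False"
  have T: "?T = levels k 0 (Suc L)" by (simp add: finite_tree_levels)
  have fin: "finite ?T" by (simp add: T finite_levels)
  have ne: "?T \<noteq> {}"
    by (auto simp: finite_tree_def kary_tree_def depth_def intro!: exI[of _ "[]"])
  have poin: "poincare ?T ((real L + 1) ^ 27)"
    using poincare_levels[of "L + 1" 0] by (simp add: finite_tree_levels add.commute)
  have ge: "1 / (real L + 1) ^ 27 \<le> spectral_gap k p ?T"
    by (rule spectral_gap_ge[OF fin ne poin]) simp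
  have "0 < 1 / (real L + 1) ^ 27" by simp
  \<comment> \<open>Only because the gap is positive does the upper bound on it turn into a lower bound on its inverse.\<close>
  then have pos: "0 < spectral_gap k p ?T" using ge by linarith
  then show "relaxation_time k p ?T \<le> (real L + 1) ^ 27"
    using ge by (simp add: relaxation_time_def field_simps)
  have q: "0 < p * (1 - p)" using p_pos p_less_1 by simp
  have "insert [] (below k [] L) = ?T"
    by (auto simp: below_def finite_tree_def kary_tree_def depth_def)
  then have v: "p * (1 - p) * ((real L + 1) ^ 3 / 3) \<le> var ?T (cluster k L []) ?o"
    using var_cluster[of L "[]" ?o] by simp
  have v0: "0 < p * (1 - p) * ((real L + 1) ^ 3 / 3)"
    using q by simp
  have "spectral_gap k p ?T \<le> dirichlet ?T (cluster k L []) ?o / var ?T (cluster k L []) ?o"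
    using v v0 by (intro spectral_gap_le fin) linarith
  also have "\<dots> \<le> (p * (1 - p) * (real L + 1)) / (p * (1 - p) * ((real L + 1) ^ 3 / 3))"
    using v v0 dirichlet_cluster[of L ?o] q unfolding T
    by (intro frac_le) (auto intro!: mult_nonneg_nonneg)
  also have "\<dots> = 3 / (real L + 1)\<^sup>2"
  proof -
    have cancel: "(q * t) / (q * (t ^ 3 / 3)) = 3 / t\<^sup>2" if "0 < q" "0 < t" for q t :: real
      using that by (simp add: power3_eq_cube power2_eq_square field_simps)
    show ?thesis by (rule cancel[OF q]) simp
  qed
  finally have "spectral_gap k p ?T \<le> 3 / (real L + 1)\<^sup>2" .
  then have "inverse (3 / (real L + 1)\<^sup>2) \<le> inverse (spectral_gap k p ?T)"
    using pos by (rule le_imp_inverse_le)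
  then show "(real L + 1)\<^sup>2 / 3 \<le> relaxation_time k p ?T"
    by (simp add: relaxation_time_def)
qed

end

theorem theorem1:
  "\<exists>\<beta>::real. \<beta> \<ge> 0 \<and>
     (\<forall>k::nat. k \<ge> 2 \<longrightarrow>
       (\<exists>c::real. c > 0 \<and>
         (\<forall>L::nat. L \<ge> 1 \<longrightarrow>
            inverse c * real L ^ 2 \<le> relaxation_time k (critical_density k) (finite_tree k L) \<and>
            relaxation_time k (critical_density k) (finite_tree k L) \<le> c * real L powr (2 + \<beta>))))"
proof (rule exI[of _ 25], intro conjI allI impI)
  fix k :: nat assume k: "2 \<le> k"
  then interpret critical_tree "critical_density k" k
    by unfold_locales (auto simp: critical_density_def)
  show "\<exists>c::real. c > 0 \<and>
         (\<forall>L::nat. L \<ge> 1 \<longrightarrow>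
            inverse c * real L ^ 2 \<le> relaxation_time k (critical_density k) (finite_tree k L) \<and>
            relaxation_time k (critical_density k) (finite_tree k L) \<le> c * real L powr (2 + 25))"
  proof (intro exI[of _ "2 ^ 27"] conjI allI impI)
    fix L :: nat assume L: "1 \<le> L"
    have "inverse (2 ^ 27) * real L ^ 2 \<le> (1 / 3) * (real L + 1)\<^sup>2"
      by (intro mult_mono power_mono) auto
    also have "\<dots> \<le> relaxation_time k (critical_density k) (finite_tree k L)"
      using relaxation_time_bounds(1)[OF L] by simp
    finally show "inverse (2 ^ 27) * real L ^ 2 \<le> relaxation_time k (critical_density k) (finite_tree k L)" .
    have "relaxation_time k (critical_density k) (finite_tree k L) \<le> (real L + 1) ^ 27"
      by (rule relaxation_time_bounds(2)[OF L])
    \<comment> \<open>Passing from \<open>L + 1\<close> levels to the depth \<open>L\<close> costs the constant \<open>2 ^ 27\<close>.\<close>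
    also have "\<dots> \<le> (2 * real L) ^ 27"
      using L by (intro power_mono) auto
    also have "\<dots> = 2 ^ 27 * real L powr (2 + 25)"
      using L powr_realpow[of "real L" 27] by (simp only: power_mult_distrib) simp
    finally show "relaxation_time k (critical_density k) (finite_tree k L) \<le> 2 ^ 27 * real L powr (2 + 25)" .
  qed simp
qed simp

end
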